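(* Consider the port-Hamiltonian system with boundary dissipation described in the context, with energy $H(t)=\frac12\int_a^b z^\top(x,t)Q(x)z(x,t)\,dx$. For some real-valued $m\in C^1([a,b])$, define $$\Psi(x)=\begin{bmatrix}-K\\ I\end{bmatrix}^\top\begin{bmatrix}W_1\\ \tilde W_1\end{bmatrix}^{-\top}Q^{-1}(x)\begin{bmatrix}W_1\\ \tilde W_1\end{bmatrix}^{-1}\begin{bmatrix}-K\\ I\end{bmatrix},$$ $$B(x)=\frac{dQ}{dx}(x)-Q(x)(P_0+G_0)P_1^{-1}+P_1^{-1}(P_0-G_0)Q(x),$$ $$A_s(x)=\frac{dm}{dx}(x)\,Q(x)-m(x)B(x),$$ the auxiliary function of the state $$w(t)=\frac12\int_a^b m(x)\,z^\top(x,t)P_1^{-1}z(x,t)\,dx,$$ and $$\varepsilon_0=\frac{\eta_Q}{\mu_m\mu_{P_1}},\qquad \varepsilon_1=\frac{2\eta_K}{\mu_m\mu_\Psi}.$$ If $A_s(x)>0$ (positive definite) on $[a,b]$, then for all $\varepsilon\in[0,\min\{\varepsilon_0,\varepsilon_1\}]$ with $\varepsilon<\varepsilon_0$, $$H(t)\le M e^{-\alpha t}H(0)\quad\text{for all }t\ge 0,\qquad M=\frac{\varepsilon_0+\varepsilon}{\varepsilon_0-\varepsilon},\qquad \alpha=\frac{c\,\varepsilon\,\varepsilon_0}{\varepsilon+\varepsilon_0},$$ along solutions of the system, where $c>0$ is a constant such that $A_s(x)\ge c\,Q(x)$ on $[a,b]$.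
   Context: Let $a<b$ be real and $n$ an even positive integer. Let $P_1=P_1^\top\in\mathbb{R}^{n\times n}$ be invertible, $P_0=-P_0^\top\in\mathbb{R}^{n\times n}$, $G_0=G_0^\top\ge 0$ in $\mathbb{R}^{n\times n}$, and let $Q\in H^1([a,b],\mathbb{R}^{n\times n})$ satisfy $Q(x)=Q(x)^\top>0$ (positive definite) for all $x\in[a,b]$. Let $W_1,\tilde W_1,W_2$ be real $\frac n2\times n$ matrices such that $\begin{bmatrix}0&W_2\\ W_1&0\end{bmatrix}$ has rank $n$ and $\begin{bmatrix}W_1\\ \tilde W_1\end{bmatrix}$ has rank $n$, and such that for some $\tilde W_2\in\mathbb{R}^{\frac n2\times n}$ $$W_1^\top\tilde W_1+\tilde W_1^\top W_1=P_1=-(W_2^\top\tilde W_2+\tilde W_2^\top W_2).$$ Let $K=K^\top>0$ in $\mathbb{R}^{\frac n2\times\frac n2}$. The system for the state $z(x,t)\in\mathbb{R}^n$, $x\in[a,b]$, $t\ge0$, with $z(\cdot,t)\in L^2([a,b],\mathbb{R}^n)$, is $$\frac{\partial z}{\partial t}(x,t)=P_1\frac{\partial}{\partial x}\big(Q(x)z(x,t)\big)+(P_0-G_0)Q(x)z(x,t),$$ with boundary conditions $$W_2Q(a)z(a,t)=0,\qquad u_b(t)+Ky_b(t)=0,$$ where $u_b(t)=W_1Q(b)z(b,t)$ and $y_b(t)=\tilde W_1Q(b)z(b,t)$. This system is well-posed. Constants: $\eta_Q=\min_{x\in[a,b]}\min\mathrm{eig}(Q(x))$, $\eta_K=\min\mathrm{eig}(K)$,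 $\mu_\Psi=\max_{x\in[a,b]}\max\mathrm{eig}(\Psi(x))$, $\mu_{P_1}=\sqrt{\max\mathrm{eig}(P_1^{-2})}$, $\mu_m=\max_{x\in[a,b]}m(x)$, where $\mathrm{eig}$ denotes the set of eigenvalues.
   Formalization: The formal theorem adds the hypothesis m(a) ≥ 0 (which with A_s > 0 gives m ≥ 0 on [a,b]); without it the claim is false, e.g. Q=I, P_0=G_0=0, P_1=diag(1,-1), K=1, m(x)=x-1+d on [0,1] with small d>0. *)

theory Defs
  imports "HOL-Analysis.Analysis"
begin

section \<open>Matrices\<close>

definition pos_semidef :: "real^'n^'n \<Rightarrow> bool" where
  "pos_semidef A \<longleftrightarrow> transpose A = A \<and> (\<forall>v. 0 \<le> v \<bullet> (A *v v))"

definition pos_def :: "real^'n^'n \<Rightarrow> bool" where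
  "pos_def A \<longleftrightarrow> transpose A = A \<and> (\<forall>v. v \<noteq> 0 \<longrightarrow> 0 < v \<bullet> (A *v v))"

text \<open>Real eigenvalues only: \<open>eig\<close> is applied to symmetric matrices exclusively, for which this
  is the whole spectrum, a finite nonempty set.\<close>

definition eig :: "real^'n^'n \<Rightarrow> real set" where
  "eig A = {l. \<exists>v. v \<noteq> 0 \<and> A *v v = l *\<^sub>R v}"

definition vblock :: "real^'c^'k \<Rightarrow> real^'c^'l \<Rightarrow> real^'c^('k + 'l)" where
  "vblock A B = (\<chi> i. case i of Inl j \<Rightarrow> A $ j | Inr j \<Rightarrow> B $ j)"

definition hblock :: "real^'c^'k \<Rightarrow> real^'d^'k \<Rightarrow> real^('c + 'd)^'k" where
  "hblock A B = (\<chi> i j. case j of Inl p \<Rightarrow> A $ i $ p | Inr q \<Rightarrow> B $ i $ q)"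

section \<open>Square integrable functions and weak derivatives on an interval\<close>

text \<open>Elements of \<open>L\<^sup>2\<close> are represented by functions; all notions below are
  insensitive to changes on null sets unless they explicitly concern \<open>H\<^sup>1\<close> functions, which are
  represented by their continuous version.\<close>

definition sq_integrable :: "real \<Rightarrow> real \<Rightarrow> (real \<Rightarrow> 'v::euclidean_space) \<Rightarrow> bool" where
  "sq_integrable a b f \<longleftrightarrow>
     f \<in> borel_measurable (lebesgue_on {a..b}) \<and>
     integrable (lebesgue_on {a..b}) (\<lambda>x. (norm (f x))\<^sup>2)"

definition l2norm :: "real \<Rightarrow> real \<Rightarrow> (real \<Rightarrow> 'v::euclidean_space) \<Rightarrow> real" where
  "l2norm a b f = sqrt (LINT x|lebesgue_on {a..b}. (norm (f x))\<^sup>2)"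

text \<open>\<open>f\<close> is (the absolutely continuous version of) an element of \<open>H\<^sup>1([a,b])\<close> with weak
  derivative \<open>f'\<close>; the latter is determined up to a null set.\<close>

definition H1_deriv ::
  "real \<Rightarrow> real \<Rightarrow> (real \<Rightarrow> 'v::euclidean_space) \<Rightarrow> (real \<Rightarrow> 'v) \<Rightarrow> bool" where
  "H1_deriv a b f f' \<longleftrightarrow>
     sq_integrable a b f' \<and>
     (\<forall>x\<in>{a..b}. f x = f a + (LINT y|lebesgue_on {a..x}. f' y))"

definition L2_continuous :: "real \<Rightarrow> real \<Rightarrow> (real \<Rightarrow> real \<Rightarrow> 'v::euclidean_space) \<Rightarrow> bool" where
  "L2_continuous a b z \<longleftrightarrow>
     (\<forall>t\<ge>0. ((\<lambda>s. l2norm a b (\<lambda>x. z s x - z t x)) \<longlongrightarrow> 0) (at t within {0..}))"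

text \<open>The Lebesgue integral of a nonintegrable function is 0, so \<open>l2norm\<close>, \<open>L2_continuous\<close> and
  \<open>has_L2_deriv\<close> are meaningful for square integrable profiles only; the solution notions below
  enforce this.

  \<open>g\<close> is the derivative at time \<open>t\<close> of the \<open>L\<^sup>2\<close>-valued curve \<open>z\<close> (one-sided at \<open>t = 0\<close>).\<close>

definition has_L2_deriv ::
  "real \<Rightarrow> real \<Rightarrow> (real \<Rightarrow> real \<Rightarrow> 'v::euclidean_space) \<Rightarrow> (real \<Rightarrow> 'v) \<Rightarrow> real \<Rightarrow> bool" where
  "has_L2_deriv a b z g t \<longleftrightarrow>
     ((\<lambda>s. l2norm a b (\<lambda>x. (z s x - z t x) /\<^sub>R (s - t) - g x)) \<longlongrightarrow> 0) (at t within {0..})"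

section \<open>The port-Hamiltonian system\<close>

text \<open>\<open>phs_op \<dots> z g\<close>: the profile \<open>z\<close> lies in the domain of the operator
  \<open>z \<mapsto> P\<^sub>1 (Qz)' + (P\<^sub>0 - G\<^sub>0) Qz\<close> with boundary conditions \<open>W\<^sub>2 (Qz)(a) = 0\<close> and
  \<open>W\<^sub>1 (Qz)(b) + K \<tilde>W\<^sub>1 (Qz)(b) = 0\<close>, and is mapped to \<open>g\<close>. Here \<open>e\<close> is the
  continuous version of \<open>Qz\<close>, which gives meaning to the boundary values.\<close>

definition phs_op ::
  "real \<Rightarrow> real \<Rightarrow> real^'n^'n \<Rightarrow> real^'n^'n \<Rightarrow> real^'n^'n \<Rightarrow> (real \<Rightarrow> real^'n^'n) \<Rightarrow>
   real^'n^'k \<Rightarrow> real^'n^'k \<Rightarrow> real^'n^'k \<Rightarrow> real^'k^'k \<Rightarrow>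
   (real \<Rightarrow> real^'n) \<Rightarrow> (real \<Rightarrow> real^'n) \<Rightarrow> bool" where
  "phs_op a b P1 P0 G0 Q W1 W1t W2 K z g \<longleftrightarrow>
     sq_integrable a b z \<and>
     (\<exists>e e'. H1_deriv a b e e' \<and>
        (AE x in lebesgue_on {a..b}. e x = Q x *v z x) \<and>
        W2 *v e a = 0 \<and>
        W1 *v e b + K *v (W1t *v e b) = 0 \<and>
        (AE x in lebesgue_on {a..b}. g x = P1 *v e' x + (P0 - G0) *v e x))"

text \<open>In a solution, \<open>z t\<close> is the profile \<open>z(\<cdot>,t)\<close>.\<close>

definition phs_classical_solution ::
  "real \<Rightarrow> real \<Rightarrow> real^'n^'n \<Rightarrow> real^'n^'n \<Rightarrow> real^'n^'n \<Rightarrow> (real \<Rightarrow> real^'n^'n) \<Rightarrow>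
   real^'n^'k \<Rightarrow> real^'n^'k \<Rightarrow> real^'n^'k \<Rightarrow> real^'k^'k \<Rightarrow>
   (real \<Rightarrow> real \<Rightarrow> real^'n) \<Rightarrow> bool" where
  "phs_classical_solution a b P1 P0 G0 Q W1 W1t W2 K z \<longleftrightarrow>
     (\<forall>t\<ge>0. \<exists>g. phs_op a b P1 P0 G0 Q W1 W1t W2 K (z t) g \<and> has_L2_deriv a b z g t)"

text \<open>Mild solutions, i.e. the trajectories for arbitrary initial states in \<open>L\<^sup>2\<close>: the
  differential equation integrated in time. The curve \<open>Z\<close> is the \<open>L\<^sup>2\<close>-valued integral
  \<open>Z(t) = \<integral>\<^sub>0\<^sup>t z(s) ds\<close>, described as the primitive of the continuous curve \<open>z\<close> that
  vanishes at time 0; it has to satisfy the boundary conditions and is mapped by the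
  operator to \<open>z(t) - z(0)\<close>.\<close>

definition phs_mild_solution ::
  "real \<Rightarrow> real \<Rightarrow> real^'n^'n \<Rightarrow> real^'n^'n \<Rightarrow> real^'n^'n \<Rightarrow> (real \<Rightarrow> real^'n^'n) \<Rightarrow>
   real^'n^'k \<Rightarrow> real^'n^'k \<Rightarrow> real^'n^'k \<Rightarrow> real^'k^'k \<Rightarrow>
   (real \<Rightarrow> real \<Rightarrow> real^'n) \<Rightarrow> bool" where
  "phs_mild_solution a b P1 P0 G0 Q W1 W1t W2 K z \<longleftrightarrow>
     (\<forall>t\<ge>0. sq_integrable a b (z t)) \<and>
     L2_continuous a b z \<and>
     (\<exists>Z. (AE x in lebesgue_on {a..b}. Z 0 x = 0) \<and>
        (\<forall>t\<ge>0. has_L2_deriv a b Z (z t) t \<and>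
           phs_op a b P1 P0 G0 Q W1 W1t W2 K (Z t) (\<lambda>x. z t x - z 0 x)))"

definition phs_energy ::
  "real \<Rightarrow> real \<Rightarrow> (real \<Rightarrow> real^'n^'n) \<Rightarrow> (real \<Rightarrow> real^'n) \<Rightarrow> real" where
  "phs_energy a b Q z = 1/2 * (LINT x|lebesgue_on {a..b}. z x \<bullet> (Q x *v z x))"

definition Psi_mat ::
  "(real \<Rightarrow> real^'n^'n) \<Rightarrow> real^'n^'k \<Rightarrow> real^'n^'k \<Rightarrow> real^'k^'k \<Rightarrow> real \<Rightarrow> real^'k^'k" where
  "Psi_mat Q W1 W1t K x =
     transpose (vblock (- K) (mat 1)) ** transpose (matrix_inv (vblock W1 W1t)) **
     matrix_inv (Q x) ** matrix_inv (vblock W1 W1t) ** vblock (- K) (mat 1)"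

definition B_mat ::
  "real^'n^'n \<Rightarrow> real^'n^'n \<Rightarrow> real^'n^'n \<Rightarrow> (real \<Rightarrow> real^'n^'n) \<Rightarrow> (real \<Rightarrow> real^'n^'n) \<Rightarrow>
   real \<Rightarrow> real^'n^'n" where
  "B_mat P1 P0 G0 Q Q' x =
     Q' x - Q x ** (P0 + G0) ** matrix_inv P1 + matrix_inv P1 ** (P0 - G0) ** Q x"

text \<open>If \<open>m(a) \<ge> 0\<close> and \<open>As_mat\<close> is positive definite almost everywhere, then \<open>m \<ge> 0\<close> on \<open>[a,b]\<close>,
  so that \<open>max m = max |m|\<close>. For \<open>m(a) < 0\<close> the decay estimate is false in general.\<close>

definition As_mat ::
  "real^'n^'n \<Rightarrow> real^'n^'n \<Rightarrow> real^'n^'n \<Rightarrow> (real \<Rightarrow> real^'n^'n) \<Rightarrow> (real \<Rightarrow> real^'n^'n) \<Rightarrow>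
   (real \<Rightarrow> real) \<Rightarrow> (real \<Rightarrow> real) \<Rightarrow> real \<Rightarrow> real^'n^'n" where
  "As_mat P1 P0 G0 Q Q' m m' x = m' x *\<^sub>R Q x - m x *\<^sub>R B_mat P1 P0 G0 Q Q' x"

end

theory Submission
  imports Defs
begin

text \<open>The functional \<open>V = H + \<epsilon>w\<close> lies between \<open>(1 - \<epsilon>/\<epsilon>\<^sub>0) H\<close> and \<open>(1 + \<epsilon>/\<epsilon>\<^sub>0) H\<close>. Along classical
  solutions \<open>H' \<le> - y\<^sub>b \<bullet> K y\<^sub>b\<close>, while integration by parts gives
  \<open>w' = 1/2 [m z \<bullet> Qz]\<^sub>a\<^sup>b - 1/2 \<integral> z \<bullet> A\<^sub>s z\<close>, whose boundary term at \<open>b\<close> is \<open>m(b) y\<^sub>b \<bullet> \<Psi>(b) y\<^sub>b / 2\<close>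
  and is absorbed by the damping when \<open>\<epsilon> \<le> \<epsilon>\<^sub>1\<close>. Hence \<open>V' \<le> - c \<epsilon> H \<le> - \<alpha> V\<close>. Mild solutions are
  limits of the classical solutions \<open>(Z(t + h) - Z(t)) / h\<close>, where \<open>Z\<close> is their time integral, so
  no well-posedness theory is needed. The sign condition \<open>m \<ge> 0\<close>, needed to compare \<open>w\<close> with \<open>H\<close>,
  follows from \<open>m(a) \<ge> 0\<close> and the positivity of \<open>A\<^sub>s\<close> by a Gronwall argument.\<close>

section \<open>Absolutely continuous functions on an interval\<close>

text \<open>\<open>Q\<close> is only H1, so \<open>Q'\<close> exists merely almost everywhere and a
  profile can be differentiated only through \<open>e = Q z\<close>. Integration by parts therefore
  needs a product rule for absolutely continuous functions and a derivative for the solution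
  \<open>z\<close> of \<open>Q z = e\<close>. The two thresholds record two independent comparisons.
  \<open>eps0\<close> is the constant in \<bar>w\<bar> \<le> H / eps0, built from a lower bound for
  \<open>Q\<close>, the maximum of \<open>m\<close> and the norm of the inverse of
  \<open>P1\<close>. \<open>eps1\<close> is the largest weight for which the boundary term at
  \<open>b\<close> is dominated by the damping through \<open>K\<close>. The rate \<alpha> solves
  \<alpha> (1 + eps / eps0) = c eps, which converts dissipation measured by H into dissipation
  measured by V, and M is the quotient of the two comparison factors. The passage to mild solutions
  costs no constant, because the classical estimate is uniform in the step h.\<close>

definition ac_deriv :: "real \<Rightarrow> real \<Rightarrow> (real \<Rightarrow> 'v::euclidean_space) \<Rightarrow> (real \<Rightarrow> 'v) \<Rightarrow> bool" where
  "ac_deriv a b f f' \<longleftrightarrow> integrable (lebesgue_on {a..b}) f' \<and>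
     (\<forall>x\<in>{a..b}. f x = f a + (LINT y|lebesgue_on {a..x}. f' y))"

lemma ac_deriv_integrable: "ac_deriv a b f f' \<Longrightarrow> integrable (lebesgue_on {a..b}) f'"
  by (simp add: ac_deriv_def)

lemma ac_deriv_eq:
  "ac_deriv a b f f' \<Longrightarrow> x \<in> {a..b} \<Longrightarrow> f x = f a + (LINT y|lebesgue_on {a..x}. f' y)"
  unfolding ac_deriv_def by blast

lemma ac_deriv_diff:
  assumes "ac_deriv a b f f'" "a \<le> u" "u \<le> v" "v \<le> b"
  shows "f v - f u = (LINT y|lebesgue_on {u..v}. f' y)"
proof -
  have i: "integrable (lebesgue_on {a..v}) f'"
    using integrable_subinterval[OF ac_deriv_integrable[OF assms(1)], of a v] assms by auto
  have "f v = f a + (LINT y|lebesgue_on {a..v}. f' y)" "f u = f a + (LINT y|lebesgue_on {a..u}. f' y)"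
    using ac_deriv_eq[OF assms(1), of v] ac_deriv_eq[OF assms(1), of u] assms(2-) by (meson atLeastAtMost_iff order_trans)+
  then show ?thesis
    using integral_combine[OF i, of u] assms by simp
qed

lemma ac_deriv_continuous:
  assumes "ac_deriv a b f f'"
  shows "continuous_on {a..b} f"
proof -
  have "continuous_on {a..b} (\<lambda>x. f a + (LINT y|lebesgue_on {a..x}. f' y))"
    using indefinite_integral_continuous_real[OF ac_deriv_integrable[OF assms]]
    by (intro continuous_intros)
  then show ?thesis
    by (rule continuous_on_eq) (use ac_deriv_eq[OF assms] in metis)
qed

lemma integrable_continuous_bilinear:
  fixes f :: "real \<Rightarrow> 'a::euclidean_space" and g :: "real \<Rightarrow> 'b::euclidean_space"
    and h :: "'a \<Rightarrow> 'b \<Rightarrow> 'c::euclidean_space"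
  assumes "bounded_bilinear h" "continuous_on {a..b} f" "integrable (lebesgue_on {a..b}) g"
  shows "integrable (lebesgue_on {a..b}) (\<lambda>x. h (f x) (g x))"
proof -
  have "(\<lambda>x. h (f x) (g x)) absolutely_integrable_on {a..b}"
  proof (rule absolutely_integrable_bounded_measurable_product[where h=h and f=f and g=g])
    show "bilinear h" using assms(1) by (simp add: bilinear_conv_bounded_bilinear)
    show "f \<in> borel_measurable (lebesgue_on {a..b})"
      using assms(2) by (simp add: continuous_imp_measurable_on_sets_lebesgue)
    show "bounded (f ` {a..b})"
      using assms(2) by (simp add: compact_continuous_image compact_imp_bounded)
    show "g absolutely_integrable_on {a..b}"
      using assms(3) by (simp add: integrable_restrict_space set_integrable_def)
  qed auto
  then show ?thesis by (simp add: integrable_restrict_space set_integrable_def)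
qed

lemma integrable_bilinear_continuous:
  fixes f :: "real \<Rightarrow> 'a::euclidean_space" and g :: "real \<Rightarrow> 'b::euclidean_space"
    and h :: "'a \<Rightarrow> 'b \<Rightarrow> 'c::euclidean_space"
  assumes "bounded_bilinear h" "integrable (lebesgue_on {a..b}) f" "continuous_on {a..b} g"
  shows "integrable (lebesgue_on {a..b}) (\<lambda>x. h (f x) (g x))"
  using integrable_continuous_bilinear[OF bounded_bilinear.flip[OF assms(1)] assms(3,2)] .

text \<open>Errors that are locally small relative to \<open>\<integral>k\<close> add up, so they vanish.\<close>

lemma ac_derivI_local:
  fixes f f' :: "real \<Rightarrow> 'v::euclidean_space"
  assumes f': "integrable (lebesgue_on {a..b}) f'" and k: "integrable (lebesgue_on {a..b}) k"
    and loc: "\<And>x \<epsilon>. x \<in> {a..b} \<Longrightarrow> \<epsilon> > 0 \<Longrightarrow>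
       \<exists>d>0. \<forall>u v. a \<le> u \<longrightarrow> u \<le> x \<longrightarrow> x \<le> v \<longrightarrow> v \<le> b \<longrightarrow> v - u < d \<longrightarrow>
         norm (f v - f u - (LINT y|lebesgue_on {u..v}. f' y)) \<le> \<epsilon> * (LINT y|lebesgue_on {u..v}. k y)"
  shows "ac_deriv a b f f'"
  unfolding ac_deriv_def
proof (intro conjI ballI)
  fix x assume x: "x \<in> {a..b}"
  define D where "D u v = f v - f u - (LINT y|lebesgue_on {u..v}. f' y)" for u v
  define J where "J u v = (LINT y|lebesgue_on {u..v}. k y)" for u v
  have D: "D u w = D u v + D v w" and J: "J u w = J u v + J v w"
    if "a \<le> u" "u \<le> v" "v \<le> w" "w \<le> b" for u v w
    using integral_combine[OF integrable_subinterval[OF f', of u w], of v]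
      integral_combine[OF integrable_subinterval[OF k, of u w], of v] that
    by (auto simp: D_def J_def)
  have bd: "norm (D a x) \<le> \<epsilon> * J a x" if \<epsilon>: "\<epsilon> > 0" for \<epsilon>
  proof -
    \<comment> \<open>The range conditions sit inside \<open>P\<close> as premises because
      \<open>Bolzano\<close> tests all pairs around a point, also those that leave [a,b].\<close>
    define P where "P u v \<longleftrightarrow> (a \<le> u \<longrightarrow> v \<le> b \<longrightarrow> norm (D u v) \<le> \<epsilon> * J u v)" for u v
    have "a \<le> x" using x by simp
    then have "P a x"
    proof (rule Bolzano)
      fix u v w assume trans: "P u v" "P v w" "u \<le> v" "v \<le> w"
      show "P u w" unfolding P_def
      proof (intro impI)
        assume *: "a \<le> u" "w \<le> b"
        have "norm (D u w) \<le> norm (D u v) + norm (D v w)"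
          using D[of u v w] * trans by (auto simp: norm_triangle_ineq)
        also have "\<dots> \<le> \<epsilon> * J u v + \<epsilon> * J v w"
          using trans * unfolding P_def by (intro add_mono) auto
        also have "\<dots> = \<epsilon> * J u w"
          using J[of u v w] * trans by (auto simp: algebra_simps)
        finally show "norm (D u w) \<le> \<epsilon> * J u w" .
      qed
    next
      fix y assume "a \<le> y" "y \<le> x"
      with x have "y \<in> {a..b}" by auto
      from loc[OF this \<epsilon>] obtain d where "d > 0" and
        d: "\<And>u v. a \<le> u \<Longrightarrow> u \<le> y \<Longrightarrow> y \<le> v \<Longrightarrow> v \<le> b \<Longrightarrow> v - u < d \<Longrightarrow>
         norm (D u v) \<le> \<epsilon> * J u v"
        unfolding D_def J_def by blast
      then show "\<exists>d>0. \<forall>u v. u \<le> y \<and> y \<le> v \<and> v - u < d \<longrightarrow> P u v"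
        unfolding P_def by blast
    qed
    then show ?thesis using x by (auto simp: P_def)
  qed
  have "norm (D a x) \<le> 0"
  proof (rule field_le_epsilon)
    fix e :: real assume "e > 0"
    \<comment> \<open>The summand 1 keeps the denominator positive when \<open>J a x\<close>
      vanishes.\<close>
    have "norm (D a x) \<le> e / (\<bar>J a x\<bar> + 1) * J a x"
      using bd[of "e / (\<bar>J a x\<bar> + 1)"] \<open>e > 0\<close> by simp
    also have "\<dots> \<le> e"
      using \<open>e > 0\<close> by (simp add: field_simps) (smt (verit) mult_left_mono)
    finally show "norm (D a x) \<le> 0 + e" by simp
  qed
  then show "f x = f a + (LINT y|lebesgue_on {a..x}. f' y)"
    by (simp add: D_def algebra_simps)
qed (rule f')

text \<open>Both points vary near \<open>x\<close>: the estimates below freeze a factor at an end of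
  [u,v] and compare it with its value at an arbitrary point in between, while \<open>x\<close> only
  locates the interval.\<close>

lemma continuous_on_interval_oscillation:
  fixes f :: "real \<Rightarrow> 'v::real_normed_vector"
  assumes "continuous_on {a..b} f" "x \<in> {a..b}" "\<epsilon> > 0"
  obtains d where "d > 0" and "\<And>s t. s \<in> {a..b} \<Longrightarrow> t \<in> {a..b} \<Longrightarrow> \<bar>s - x\<bar> < d \<Longrightarrow> \<bar>t - x\<bar> < d \<Longrightarrow>
    norm (f s - f t) \<le> \<epsilon>"
proof -
  obtain d where "d > 0" and d: "\<And>s. s \<in> {a..b} \<Longrightarrow> dist s x < d \<Longrightarrow> dist (f s) (f x) < \<epsilon> / 2"
    using assms unfolding continuous_on_iff by (metis half_gt_zero)
  show ?thesis
  proof (rule that[OF \<open>d > 0\<close>])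
    fix s t assume "s \<in> {a..b}" "t \<in> {a..b}" "\<bar>s - x\<bar> < d" "\<bar>t - x\<bar> < d"
    then have "dist (f s) (f x) < \<epsilon> / 2" "dist (f t) (f x) < \<epsilon> / 2"
      using d[of s] d[of t] by (simp_all add: dist_real_def)
    then show "norm (f s - f t) \<le> \<epsilon>"
      by (metis dist_norm dist_triangle_half_l less_eq_real_def dist_commute)
  qed
qed

lemma ac_deriv_bilinear:
  fixes f f' :: "real \<Rightarrow> 'a::euclidean_space" and g g' :: "real \<Rightarrow> 'b::euclidean_space"
    and h :: "'a \<Rightarrow> 'b \<Rightarrow> 'c::euclidean_space"
  assumes h: "bounded_bilinear h" and f: "ac_deriv a b f f'" and g: "ac_deriv a b g g'"
  shows "ac_deriv a b (\<lambda>x. h (f x) (g x)) (\<lambda>x. h (f' x) (g x) + h (f x) (g' x))"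
proof (rule ac_derivI_local[where k="\<lambda>x. norm (f' x) + norm (g' x)"])
  note if' = ac_deriv_integrable[OF f] and ig' = ac_deriv_integrable[OF g]
  note cf = ac_deriv_continuous[OF f] and cg = ac_deriv_continuous[OF g]
  interpret bounded_bilinear h by (rule h)
  note i1 = integrable_bilinear_continuous[OF h] and i2 = integrable_continuous_bilinear[OF h]
  show "integrable (lebesgue_on {a..b}) (\<lambda>x. h (f' x) (g x) + h (f x) (g' x))"
    by (intro Bochner_Integration.integrable_add i1 i2 if' ig' cf cg)
  show "integrable (lebesgue_on {a..b}) (\<lambda>x. norm (f' x) + norm (g' x))"
    by (intro Bochner_Integration.integrable_add integrable_norm if' ig')
  obtain C where "C > 0" and C: "\<And>x y. norm (h x y) \<le> norm x * norm y * C"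
    using pos_bounded by blast
  fix x \<epsilon> :: real assume x: "x \<in> {a..b}" and "\<epsilon> > 0"
  then have "\<epsilon> / C > 0" using \<open>C > 0\<close> by simp
  obtain d1 where "d1 > 0" and d1: "\<And>s t. s \<in> {a..b} \<Longrightarrow> t \<in> {a..b} \<Longrightarrow> \<bar>s - x\<bar> < d1 \<Longrightarrow> \<bar>t - x\<bar> < d1 \<Longrightarrow>
    norm (f s - f t) \<le> \<epsilon> / C"
    using continuous_on_interval_oscillation[OF cf x \<open>\<epsilon> / C > 0\<close>] by metis
  obtain d2 where "d2 > 0" and d2: "\<And>s t. s \<in> {a..b} \<Longrightarrow> t \<in> {a..b} \<Longrightarrow> \<bar>s - x\<bar> < d2 \<Longrightarrow> \<bar>t - x\<bar> < d2 \<Longrightarrow>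
    norm (g s - g t) \<le> \<epsilon> / C"
    using continuous_on_interval_oscillation[OF cg x \<open>\<epsilon> / C > 0\<close>] by metis
  show "\<exists>d>0. \<forall>u v. a \<le> u \<longrightarrow> u \<le> x \<longrightarrow> x \<le> v \<longrightarrow> v \<le> b \<longrightarrow> v - u < d \<longrightarrow>
         norm (h (f v) (g v) - h (f u) (g u) - (LINT y|lebesgue_on {u..v}. h (f' y) (g y) + h (f y) (g' y)))
          \<le> \<epsilon> * (LINT y|lebesgue_on {u..v}. norm (f' y) + norm (g' y))"
  proof (intro exI[of _ "min d1 d2"] conjI allI impI)
    fix u v assume uv: "a \<le> u" "u \<le> x" "x \<le> v" "v \<le> b" "v - u < min d1 d2"
    have sub: "{u..v} \<subseteq> {a..b}" using uv by auto
    note jf = integrable_subinterval[OF if' sub] and jg = integrable_subinterval[OF ig' sub]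
    note kf = continuous_on_subset[OF cf sub] and kg = continuous_on_subset[OF cg sub]
    note ii = i1[OF jf kg] i2[OF kf jg] i1[OF jf, OF continuous_on_const] i2[OF continuous_on_const jg]
    have "h (f v) (g v) - h (f u) (g u) = h (f v - f u) (g u) + h (f v) (g v - g u)"
      by (simp add: diff_left diff_right)
    also have "\<dots> = (LINT y|lebesgue_on {u..v}. h (f' y) (g u)) + (LINT y|lebesgue_on {u..v}. h (f v) (g' y))"
      using integral_bounded_linear[OF bounded_linear_left jf, of "g u"] uv
        integral_bounded_linear[OF bounded_linear_right jg, of "f v"]
      by (simp add: ac_deriv_diff[OF f, of u v] ac_deriv_diff[OF g, of u v])
    finally have "h (f v) (g v) - h (f u) (g u) - (LINT y|lebesgue_on {u..v}. h (f' y) (g y) + h (f y) (g' y))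
      = (LINT y|lebesgue_on {u..v}. (h (f' y) (g u) + h (f v) (g' y)) - (h (f' y) (g y) + h (f y) (g' y)))"
      using ii by simp
    also have "norm \<dots> \<le> (LINT y|lebesgue_on {u..v}. \<epsilon> * (norm (f' y) + norm (g' y)))"
    proof (rule Bochner_Integration.integral_norm_bound_integral)
      show "integrable (lebesgue_on {u..v}) (\<lambda>x. h (f' x) (g u) + h (f v) (g' x) - (h (f' x) (g x) + h (f x) (g' x)))"
        using ii by simp
      show "integrable (lebesgue_on {u..v}) (\<lambda>y. \<epsilon> * (norm (f' y) + norm (g' y)))"
        using jf jg by simp
      fix y assume "y \<in> space (lebesgue_on {u..v})"
      then have y: "y \<in> {u..v}" by simp
      have f1: "norm (f v - f y) \<le> \<epsilon> / C" and g1: "norm (g u - g y) \<le> \<epsilon> / C"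
        using y uv by (auto intro!: d1 d2)
      have "h (f' y) (g u) + h (f v) (g' y) - (h (f' y) (g y) + h (f y) (g' y)) =
          h (f' y) (g u - g y) + h (f v - f y) (g' y)"
        by (simp add: diff_left diff_right)
      also have "norm \<dots> \<le> norm (f' y) * norm (g u - g y) * C + norm (f v - f y) * norm (g' y) * C"
        by (intro order_trans[OF norm_triangle_ineq] add_mono C)
      also have "\<dots> \<le> norm (f' y) * (\<epsilon> / C) * C + (\<epsilon> / C) * norm (g' y) * C"
        using \<open>C > 0\<close> f1 g1 by (intro add_mono mult_right_mono mult_left_mono) auto
      also have "\<dots> = \<epsilon> * (norm (f' y) + norm (g' y))"
        using \<open>C > 0\<close> by (simp add: algebra_simps)
      finally show "norm (h (f' y) (g u) + h (f v) (g' y) - (h (f' y) (g y) + h (f y) (g' y)))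
         \<le> \<epsilon> * (norm (f' y) + norm (g' y))" .
    qed
    finally show "norm (h (f v) (g v) - h (f u) (g u) - (LINT y|lebesgue_on {u..v}. h (f' y) (g y) + h (f y) (g' y)))
          \<le> \<epsilon> * (LINT y|lebesgue_on {u..v}. norm (f' y) + norm (g' y))" by simp
  qed (use \<open>d1 > 0\<close> \<open>d2 > 0\<close> in auto)
qed

lemma bounded_bilinear_matrix_vector_mult:
  "bounded_bilinear ((*v) :: real^'n^'m \<Rightarrow> real^'n \<Rightarrow> real^'m)"
  unfolding bilinear_conv_bounded_bilinear[symmetric] bilinear_def
  by (auto intro!: linearI simp: matrix_vector_mult_add_rdistrib matrix_vector_right_distrib
      scaleR_matrix_vector_assoc matrix_vector_mult_scaleR)

text \<open>Formally Q z' = e' - Q' z for z = R e. The inverse \<open>R\<close> is never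
  differentiated: the increment of z comes from an exact identity for Q v (z v - z u), multiplied by
  R v, so continuity of \<open>R\<close> suffices.\<close>

lemma ac_deriv_solve:
  fixes Q Q' R :: "real \<Rightarrow> real^'n^'n" and e e' :: "real \<Rightarrow> real^'n"
  assumes Q: "ac_deriv a b Q Q'" and e: "ac_deriv a b e e'" and cR: "continuous_on {a..b} R"
    and R: "\<And>x. x \<in> {a..b} \<Longrightarrow> R x ** Q x = mat 1 \<and> Q x ** R x = mat 1"
  shows "ac_deriv a b (\<lambda>x. R x *v e x) (\<lambda>x. R x *v (e' x - Q' x *v (R x *v e x)))"
proof (rule ac_derivI_local[where k="\<lambda>x. norm (e' x) + norm (Q' x)"])
  note bb = bounded_bilinear_matrix_vector_mult
  interpret mv: bounded_bilinear "(*v) :: real^'n^'n \<Rightarrow> real^'n \<Rightarrow> real^'n" by (rule bb)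
  note ie' = ac_deriv_integrable[OF e] and iQ' = ac_deriv_integrable[OF Q]
  note ce = ac_deriv_continuous[OF e] and cQ = ac_deriv_continuous[OF Q]
  note i1 = integrable_bilinear_continuous[OF bb] and i2 = integrable_continuous_bilinear[OF bb]
  define z where "z x = R x *v e x" for x
  have cz: "continuous_on {a..b} z"
    unfolding z_def by (rule mv.continuous_on[OF cR ce])
  show "integrable (lebesgue_on {a..b}) (\<lambda>x. R x *v (e' x - Q' x *v (R x *v e x)))"
    unfolding z_def[symmetric]
    by (intro i2 cR Bochner_Integration.integrable_diff ie' i1 iQ' cz)
  show "integrable (lebesgue_on {a..b}) (\<lambda>x. norm (e' x) + norm (Q' x))"
    by (intro Bochner_Integration.integrable_add integrable_norm ie' iQ')
  obtain C where "C > 0" and C: "\<And>(A::real^'n^'n) y. norm (A *v y) \<le> norm A * norm y * C"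
    using mv.pos_bounded by blast
  obtain B1 where B1: "\<And>x. x \<in> {a..b} \<Longrightarrow> norm (R x) \<le> B1"
    using compact_continuous_image[OF cR] compact_imp_bounded by (force simp: bounded_iff)
  obtain B2 where B2: "\<And>x. x \<in> {a..b} \<Longrightarrow> norm (z x) \<le> B2"
    using compact_continuous_image[OF cz] compact_imp_bounded by (force simp: bounded_iff)
  \<comment> \<open>\<open>L\<close> dominates the sum of the three error coefficients below, one at
    the norm of e' and two at the norm of Q'; \<open>B1\<close> and \<open>B2\<close> bound
    \<open>R\<close> and \<open>z\<close> on [a,b].\<close>
  define L where "L = C + C * (C * \<bar>B2\<bar>) + C * (C * \<bar>B1\<bar>)"
  have "L > 0" using \<open>C > 0\<close> by (simp add: L_def add_pos_nonneg)
  fix x \<epsilon> :: real assume x: "x \<in> {a..b}" and "\<epsilon> > 0"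
  define \<delta> where "\<delta> = \<epsilon> / L"
  have "\<delta> > 0" using \<open>\<epsilon> > 0\<close> \<open>L > 0\<close> by (simp add: \<delta>_def)
  obtain d1 where "d1 > 0" and d1: "\<And>s t. s \<in> {a..b} \<Longrightarrow> t \<in> {a..b} \<Longrightarrow> \<bar>s - x\<bar> < d1 \<Longrightarrow> \<bar>t - x\<bar> < d1 \<Longrightarrow>
    norm (R s - R t) \<le> \<delta>"
    using continuous_on_interval_oscillation[OF cR x \<open>\<delta> > 0\<close>] by metis
  obtain d2 where "d2 > 0" and d2: "\<And>s t. s \<in> {a..b} \<Longrightarrow> t \<in> {a..b} \<Longrightarrow> \<bar>s - x\<bar> < d2 \<Longrightarrow> \<bar>t - x\<bar> < d2 \<Longrightarrow>
    norm (z s - z t) \<le> \<delta>"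
    using continuous_on_interval_oscillation[OF cz x \<open>\<delta> > 0\<close>] by metis
  show "\<exists>d>0. \<forall>u v. a \<le> u \<longrightarrow> u \<le> x \<longrightarrow> x \<le> v \<longrightarrow> v \<le> b \<longrightarrow> v - u < d \<longrightarrow>
         norm (R v *v e v - R u *v e u - (LINT y|lebesgue_on {u..v}. R y *v (e' y - Q' y *v (R y *v e y))))
          \<le> \<epsilon> * (LINT y|lebesgue_on {u..v}. norm (e' y) + norm (Q' y))"
    unfolding z_def[symmetric]
  proof (intro exI[of _ "min d1 d2"] conjI allI impI)
    fix u v assume uv: "a \<le> u" "u \<le> x" "x \<le> v" "v \<le> b" "v - u < min d1 d2"
    have sub: "{u..v} \<subseteq> {a..b}" using uv by auto
    note je = integrable_subinterval[OF ie' sub] and jQ = integrable_subinterval[OF iQ' sub]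
    note kR = continuous_on_subset[OF cR sub] and kz = continuous_on_subset[OF cz sub]
    have i3: "integrable (lebesgue_on {u..v}) (\<lambda>y. e' y - Q' y *v z u)"
      by (intro Bochner_Integration.integrable_diff je i1 jQ continuous_on_const)
    have i4: "integrable (lebesgue_on {u..v}) (\<lambda>y. R v *v (e' y - Q' y *v z u))"
      by (intro i2 i3 continuous_on_const)
    have i5: "integrable (lebesgue_on {u..v}) (\<lambda>y. R y *v (e' y - Q' y *v z y))"
      by (intro i2 kR Bochner_Integration.integrable_diff je i1 jQ kz)
    have Qz: "Q y *v z y = e y" "R y *v (Q y *v w) = w" if "y \<in> {a..b}" for y w
      using R[OF that] by (simp_all add: z_def matrix_vector_mul_assoc)
    \<comment> \<open>A discrete product rule: with \<open>z\<close> frozen at \<open>u\<close>,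
      only increments of \<open>e\<close> and \<open>Q\<close> remain, and these are
      integrals.\<close>
    have "Q v *v (z v - z u) = (e v - e u) - (Q v - Q u) *v z u"
      using uv Qz by (simp add: mv.diff_left mv.diff_right)
    also have "\<dots> = (LINT y|lebesgue_on {u..v}. e' y - Q' y *v z u)"
      using integral_bounded_linear[OF mv.bounded_linear_left jQ, of "z u"] uv je i1[OF jQ continuous_on_const]
      by (simp add: ac_deriv_diff[OF e, of u v] ac_deriv_diff[OF Q, of u v])
    finally have "z v - z u = (LINT y|lebesgue_on {u..v}. R v *v (e' y - Q' y *v z u))"
      using integral_bounded_linear[OF mv.bounded_linear_right i3, of "R v"] uv Qz(2)[of v "z v - z u"]
      by simp
    then have "z v - z u - (LINT y|lebesgue_on {u..v}. R y *v (e' y - Q' y *v z y))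
      = (LINT y|lebesgue_on {u..v}. R v *v (e' y - Q' y *v z u) - R y *v (e' y - Q' y *v z y))"
      using i4 i5 by simp
    also have "norm \<dots> \<le> (LINT y|lebesgue_on {u..v}. \<epsilon> * (norm (e' y) + norm (Q' y)))"
    proof (rule Bochner_Integration.integral_norm_bound_integral)
      show "integrable (lebesgue_on {u..v}) (\<lambda>y. R v *v (e' y - Q' y *v z u) - R y *v (e' y - Q' y *v z y))"
        using i4 i5 by simp
      show "integrable (lebesgue_on {u..v}) (\<lambda>y. \<epsilon> * (norm (e' y) + norm (Q' y)))"
        using je jQ by simp
      fix y assume "y \<in> space (lebesgue_on {u..v})"
      then have y: "y \<in> {u..v}" by simp
      have f1: "norm (R v - R y) \<le> \<delta>" and g1: "norm (z y - z u) \<le> \<delta>"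
        using y uv by (auto intro!: d1 d2)
      have b1: "norm (R y) \<le> \<bar>B1\<bar>" and b2: "norm (z u) \<le> \<bar>B2\<bar>"
        using B1[of y] B2[of u] y uv by auto
      have "R v *v (e' y - Q' y *v z u) - R y *v (e' y - Q' y *v z y) =
          (R v - R y) *v e' y - (R v - R y) *v (Q' y *v z u) + R y *v (Q' y *v (z y - z u))"
        by (simp add: mv.diff_left mv.diff_right algebra_simps)
      also have "norm \<dots> \<le> norm ((R v - R y) *v e' y) + norm ((R v - R y) *v (Q' y *v z u))
          + norm (R y *v (Q' y *v (z y - z u)))"
        by (intro order_trans[OF norm_triangle_ineq] add_mono norm_triangle_ineq4 order_refl)
      also have "\<dots> \<le> \<delta> * norm (e' y) * C + \<delta> * (norm (Q' y) * \<bar>B2\<bar> * C) * C + \<bar>B1\<bar> * (norm (Q' y) * \<delta> * C) * C"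
        using \<open>C > 0\<close> \<open>\<delta> > 0\<close> f1 g1 b1 b2
        by (intro add_mono order_trans[OF C] mult_mono) auto
      also have "\<dots> \<le> \<delta> * L * (norm (e' y) + norm (Q' y))"
      proof -
        have "\<delta> * L * (norm (e' y) + norm (Q' y)) - (\<delta> * norm (e' y) * C + \<delta> * (norm (Q' y) * \<bar>B2\<bar> * C) * C + \<bar>B1\<bar> * (norm (Q' y) * \<delta> * C) * C)
          = \<delta> * (C * norm (Q' y) + (C * (C * \<bar>B2\<bar>) + C * (C * \<bar>B1\<bar>)) * norm (e' y))"
          by (simp add: L_def algebra_simps)
        also have "\<dots> \<ge> 0" using \<open>C > 0\<close> \<open>\<delta> > 0\<close> by (simp add: add_nonneg_nonneg)
        finally show ?thesis by simp
      qed
      also have "\<dots> = \<epsilon> * (norm (e' y) + norm (Q' y))"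
        using \<open>L > 0\<close> by (simp add: \<delta>_def)
      finally show "norm (R v *v (e' y - Q' y *v z u) - R y *v (e' y - Q' y *v z y))
         \<le> \<epsilon> * (norm (e' y) + norm (Q' y))" .
    qed
    finally show "norm (z v - z u - (LINT y|lebesgue_on {u..v}. R y *v (e' y - Q' y *v z y)))
          \<le> \<epsilon> * (LINT y|lebesgue_on {u..v}. norm (e' y) + norm (Q' y))" by simp
  qed (use \<open>d1 > 0\<close> \<open>d2 > 0\<close> in auto)
qed

section \<open>Symmetric matrices\<close>

lemma inner_matrix_symmetric:
  fixes A :: "real^'n^'n"
  assumes "transpose A = A"
  shows "x \<bullet> (A *v y) = (A *v x) \<bullet> y"
  by (metis assms dot_lmul_matrix transpose_matrix_vector)

text \<open>The discriminant criterion. It serves twice, for the kernel of a semidefinite matrix and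
  for the Cauchy-Schwarz inequality in L2.\<close>

lemma nonneg_quadratic_imp:
  fixes p q r :: real
  assumes "\<And>t. 0 \<le> p + 2 * t * q + t\<^sup>2 * r" and r: "0 \<le> r"
  shows "q\<^sup>2 \<le> p * r"
proof (cases "r = 0")
  case True
  have "q = 0"
  proof (rule ccontr)
    assume "q \<noteq> 0"
    \<comment> \<open>At this \<open>t\<close> the function, affine for r = 0, takes the value
      -1.\<close>
    then show False using assms(1)[of "- (p + 1) / (2 * q)"] True by (simp add: field_simps)
  qed
  then show ?thesis using True by simp
next
  case False
  \<comment> \<open>Evaluation at the minimiser.\<close>
  have "0 \<le> p + 2 * (- q / r) * q + (- q / r)\<^sup>2 * r" by (rule assms)
  also have "\<dots> = p - q\<^sup>2 / r" using False by (simp add: power2_eq_square field_simps)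
  finally show ?thesis using False r by (simp add: field_simps)
qed

text \<open>Moving from \<open>v\<close> in the direction w = S v gives a nonnegative quadratic
  polynomial without constant term, so its linear coefficient w \<bullet> w must vanish. It later
  turns a maximiser of a form into an eigenvector.\<close>

lemma pos_semidef_form_eq_0:
  fixes S :: "real^'n^'n"
  assumes S: "pos_semidef S" and v: "v \<bullet> (S *v v) = 0"
  shows "S *v v = 0"
proof -
  define w where "w = S *v v"
  interpret mv: bounded_bilinear "(*v) :: real^'n^'n \<Rightarrow> real^'n \<Rightarrow> real^'n"
    by (rule bounded_bilinear_matrix_vector_mult)
  have vw: "v \<bullet> (S *v w) = w \<bullet> w"
    using inner_matrix_symmetric[of S v w] S by (simp add: w_def pos_semidef_def)
  have "(w \<bullet> w)\<^sup>2 \<le> 0 * (w \<bullet> (S *v w))"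
  proof (rule nonneg_quadratic_imp)
    fix t
    have "0 \<le> (v + t *\<^sub>R w) \<bullet> (S *v (v + t *\<^sub>R w))"
      using S by (simp add: pos_semidef_def)
    also have "\<dots> = 0 + 2 * t * (w \<bullet> w) + t\<^sup>2 * (w \<bullet> (S *v w))"
      using v vw by (simp add: mv.add_right mv.scaleR_right inner_add w_def[symmetric] power2_eq_square algebra_simps)
    finally show "0 \<le> 0 + 2 * t * (w \<bullet> w) + t\<^sup>2 * (w \<bullet> (S *v w))" .
  qed (use S in \<open>simp add: pos_semidef_def\<close>)
  then show ?thesis by (simp add: w_def)
qed

text \<open>Eigenvectors of a symmetric matrix for different eigenvalues are orthogonal, so choosing
  one per eigenvalue gives an independent set. Finiteness is what makes \<open>Max (eig A)\<close>
  and \<open>Min (eig A)\<close> usable.\<close>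

lemma finite_eig:
  fixes A :: "real^'n^'n"
  assumes A: "transpose A = A"
  shows "finite (eig A)"
proof -
  have "\<forall>l\<in>eig A. \<exists>v. v \<noteq> 0 \<and> A *v v = l *\<^sub>R v" by (simp add: eig_def)
  then obtain f where f: "\<And>l. l \<in> eig A \<Longrightarrow> f l \<noteq> 0 \<and> A *v f l = l *\<^sub>R f l"
    by metis
  have orth: "f l \<bullet> f k = 0" if "l \<in> eig A" "k \<in> eig A" "l \<noteq> k" for l k
  proof -
    have "k * (f l \<bullet> f k) = l * (f l \<bullet> f k)"
      using inner_matrix_symmetric[OF A, of "f l" "f k"] f that by simp
    then show ?thesis using that by simp
  qed
  have inj: "inj_on f (eig A)"
    by (rule inj_onI) (metis f inner_eq_zero_iff orth)
  have "independent (f ` eig A)"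
  proof (rule pairwise_orthogonal_independent)
    show "pairwise orthogonal (f ` eig A)"
      unfolding pairwise_def orthogonal_def using orth by (metis imageE)
    show "0 \<notin> f ` eig A" using f by (metis imageE)
  qed
  then show ?thesis using inj independent_imp_finite finite_imageD by blast
qed

text \<open>Rayleigh's principle: the form attains its maximum l on the unit sphere at some w, so l
  times the identity minus A is positive semidefinite with vanishing form at w. Its kernel then
  contains w. Existence of a real eigenvalue and the form bound thus come together, without
  diagonalisation.\<close>

lemma ex_dominating_eigenvalue:
  fixes A :: "real^'n^'n"
  assumes A: "transpose A = A"
  shows "\<exists>l\<in>eig A. \<forall>v. v \<bullet> (A *v v) \<le> l * (norm v)\<^sup>2"
proof -
  interpret mv: bounded_bilinear "(*v) :: real^'n^'n \<Rightarrow> real^'n \<Rightarrow> real^'n"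
    by (rule bounded_bilinear_matrix_vector_mult)
  have "\<exists>w\<in>sphere 0 1. \<forall>v\<in>sphere 0 1. v \<bullet> (A *v v) \<le> w \<bullet> (A *v w)"
  proof (rule continuous_attains_sup)
    have "norm (axis undefined 1 :: real^'n) = 1" by simp
    then show "sphere (0::real^'n) 1 \<noteq> {}" by (metis empty_iff mem_sphere_0)
    show "continuous_on (sphere 0 1) (\<lambda>v. v \<bullet> (A *v v))"
      by (intro continuous_intros linear_continuous_on matrix_vector_mul_bounded_linear)
  qed simp
  then obtain w where w: "norm w = 1" and max: "\<And>v. norm v = 1 \<Longrightarrow> v \<bullet> (A *v v) \<le> w \<bullet> (A *v w)"
    by auto
  define l where "l = w \<bullet> (A *v w)"
  have bd: "v \<bullet> (A *v v) \<le> l * (norm v)\<^sup>2" for v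
  proof (cases "v = 0")
    case False
    have "(v /\<^sub>R norm v) \<bullet> (A *v (v /\<^sub>R norm v)) \<le> l"
      unfolding l_def using False by (intro max) simp
    then have "v \<bullet> (A *v v) / (norm v)\<^sup>2 \<le> l"
      by (simp add: mv.scaleR_right power2_eq_square field_simps)
    then show ?thesis using False by (simp add: field_simps)
  qed (simp add: mv.zero_right)
  have tr: "transpose (l *\<^sub>R mat 1 - A) = l *\<^sub>R mat 1 - A"
  proof -
    have "transpose (l *\<^sub>R mat 1 - A) = l *\<^sub>R transpose (mat 1) - transpose A"
      by (simp add: transpose_def vec_eq_iff)
    then show ?thesis by (simp add: A)
  qed
  have lv: "(l *\<^sub>R mat 1 - A) *v v = l *\<^sub>R v - A *v v" for v
    by (simp add: mv.diff_left mv.scaleR_left)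
  have "(l *\<^sub>R mat 1 - A) *v w = 0"
  proof (rule pos_semidef_form_eq_0)
    show "pos_semidef (l *\<^sub>R mat 1 - A)"
      using bd tr by (simp add: pos_semidef_def lv inner_diff_right power2_norm_eq_inner)
    show "w \<bullet> ((l *\<^sub>R mat 1 - A) *v w) = 0"
      using w unfolding lv by (simp add: inner_diff_right l_def norm_eq_1)
  qed
  then have "A *v w = l *\<^sub>R w" by (simp add: lv)
  moreover have "w \<noteq> 0" using w by auto
  ultimately have "l \<in> eig A" by (auto simp: eig_def)
  then show ?thesis using bd by blast
qed

lemma eig_nonempty: "transpose A = A \<Longrightarrow> eig A \<noteq> {}"
  using ex_dominating_eigenvalue by blast

lemma form_le_Max_eig:
  fixes A :: "real^'n^'n"
  assumes A: "transpose A = A"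
  shows "v \<bullet> (A *v v) \<le> Max (eig A) * (norm v)\<^sup>2"
proof -
  obtain l where l: "l \<in> eig A" "v \<bullet> (A *v v) \<le> l * (norm v)\<^sup>2"
    using ex_dominating_eigenvalue[OF A] by blast
  have "l \<le> Max (eig A)" using finite_eig[OF A] l by simp
  then have "l * (norm v)\<^sup>2 \<le> Max (eig A) * (norm v)\<^sup>2" by (intro mult_right_mono) auto
  then show ?thesis using l by linarith
qed

text \<open>The dominating eigenvalue of - A is the negative of an eigenvalue of A.\<close>

lemma Min_eig_le_form:
  fixes A :: "real^'n^'n"
  assumes A: "transpose A = A"
  shows "Min (eig A) * (norm v)\<^sup>2 \<le> v \<bullet> (A *v v)"
proof -
  interpret mv: bounded_bilinear "(*v) :: real^'n^'n \<Rightarrow> real^'n \<Rightarrow> real^'n"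
    by (rule bounded_bilinear_matrix_vector_mult)
  have "transpose (- A) = - A"
    by (metis A scaleR_minus1_left transpose_scalar)
  from ex_dominating_eigenvalue[OF this] obtain l
    where l: "l \<in> eig (- A)" "\<And>v. v \<bullet> (- A *v v) \<le> l * (norm v)\<^sup>2" by blast
  from l(1) obtain w where "w \<noteq> 0" "A *v w = (- l) *\<^sub>R w"
    by (auto simp: eig_def mv.minus_left minus_equation_iff eq_commute[of "- (_ :: real^'n)"])
  then have "- l \<in> eig A" by (auto simp: eig_def)
  then have "Min (eig A) \<le> - l" using finite_eig[OF A] by simp
  then have "Min (eig A) * (norm v)\<^sup>2 \<le> - l * (norm v)\<^sup>2" by (intro mult_right_mono) auto
  then show ?thesis using l(2)[of v] by (simp add: mv.minus_left)
qed

lemma Min_eig_nonneg: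
  fixes A :: "real^'n^'n"
  assumes "pos_semidef A"
  shows "0 \<le> Min (eig A)"
proof -
  have A: "transpose A = A" using assms by (simp add: pos_semidef_def)
  have "Min (eig A) \<in> eig A" using finite_eig[OF A] eig_nonempty[OF A] by (rule Min_in)
  then obtain w where w: "w \<noteq> 0" "A *v w = Min (eig A) *\<^sub>R w" by (auto simp: eig_def)
  have "0 \<le> w \<bullet> (A *v w)" using assms by (simp add: pos_semidef_def)
  then have "0 \<le> Min (eig A) * (w \<bullet> w)" using w by simp
  moreover have "0 < w \<bullet> w" using w by simp
  ultimately show ?thesis by (simp add: zero_le_mult_iff)
qed

lemma Max_eig_le:
  fixes A :: "real^'n^'n"
  assumes A: "transpose A = A" and bd: "\<And>v. v \<bullet> (A *v v) \<le> C * (norm v)\<^sup>2"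
  shows "Max (eig A) \<le> C"
proof -
  have "Max (eig A) \<in> eig A" using finite_eig[OF A] eig_nonempty[OF A] by (rule Max_in)
  then obtain w where w: "w \<noteq> 0" "A *v w = Max (eig A) *\<^sub>R w" by (auto simp: eig_def)
  have "w \<bullet> (A *v w) \<le> C * (norm w)\<^sup>2" by (rule bd)
  then show ?thesis using w by (simp add: power2_norm_eq_inner)
qed

lemma pos_def_imp_pos_semidef: "pos_def A \<Longrightarrow> pos_semidef A"
  unfolding pos_def_def pos_semidef_def
  by (metis inner_zero_left less_eq_real_def)

section \<open>Inverse matrices\<close>

lemma matrix_inv_inverse:
  assumes "A ** B = mat 1" "B ** A = mat 1"
  shows "A ** matrix_inv A = mat 1 \<and> matrix_inv A ** A = mat 1"
  unfolding matrix_inv_def by (rule someI_ex) (use assms in blast)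

lemma invertible_matrix_inv:
  "invertible A \<Longrightarrow> A ** matrix_inv A = mat 1 \<and> matrix_inv A ** A = mat 1"
  by (metis invertible_def matrix_inv_inverse)

text \<open>Intended for \<open>vblock W1 W1t\<close>, whose row index type 'k + 'k differs from 'n
  although the cardinalities agree. Injectivity and surjectivity give one-sided inverses, which then
  coincide.\<close>

lemma full_rank_matrix_inv_left:
  fixes A :: "real^'n^'m"
  assumes "rank A = CARD('n)" "CARD('n) = CARD('m)"
  shows "matrix_inv A ** A = mat 1"
proof -
  have "inj ((*v) A)" "surj ((*v) A)"
    using assms full_rank_injective[of A] full_rank_surjective[of A] by simp_all
  then obtain B C where B: "B ** A = mat 1" and C: "A ** C = mat 1"
    by (metis matrix_left_invertible_injective matrix_right_invertible_surjective)
  have "B = B ** (A ** C)" by (simp add: C)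
  also have "\<dots> = C" by (metis B matrix_mul_assoc matrix_mul_lid)
  finally show ?thesis using matrix_inv_inverse[of A B] B C by simp
qed

lemma pos_def_invertible:
  fixes A :: "real^'n^'n"
  assumes "pos_def A"
  shows "invertible A"
proof -
  have "\<forall>x. A *v x = 0 \<longrightarrow> x = 0"
    using assms by (metis inner_zero_right less_irrefl pos_def_def)
  then show ?thesis using matrix_left_invertible_ker invertible_left_inverse by blast
qed

lemma transpose_matrix_inv:
  fixes A :: "real^'n^'n"
  assumes "transpose A = A" "invertible A"
  shows "transpose (matrix_inv A) = matrix_inv A"
proof -
  have i: "A ** matrix_inv A = mat 1 \<and> matrix_inv A ** A = mat 1"
    using assms(2) by (rule invertible_matrix_inv)
  then have "transpose (matrix_inv A) ** A = mat 1"
    by (metis assms(1) matrix_transpose_mul transpose_mat)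
  then show ?thesis using i by (metis matrix_mul_assoc matrix_mul_lid matrix_mul_rid)
qed

text \<open>Substituting v = A w turns the form of the inverse at v into the form of A at w.\<close>

lemma pos_semidef_matrix_inv:
  fixes A :: "real^'n^'n"
  assumes "pos_def A"
  shows "pos_semidef (matrix_inv A)"
proof -
  have A: "transpose A = A" "invertible A"
    using assms pos_def_invertible by (auto simp: pos_def_def)
  have "0 \<le> v \<bullet> (matrix_inv A *v v)" for v
  proof -
    have "v \<bullet> (matrix_inv A *v v) = (matrix_inv A *v v) \<bullet> (A *v (matrix_inv A *v v))"
      using invertible_matrix_inv[OF A(2)] by (simp add: matrix_vector_mul_assoc inner_commute)
    then show ?thesis
      using pos_def_imp_pos_semidef[OF assms] by (simp add: pos_semidef_def)
  qed
  then show ?thesis using transpose_matrix_inv[OF A] by (simp add: pos_semidef_def)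
qed

lemma continuous_on_det:
  fixes A :: "'a::topological_space \<Rightarrow> real^'n^'n"
  assumes "\<And>i j. continuous_on S (\<lambda>x. A x $ i $ j)"
  shows "continuous_on S (\<lambda>x. det (A x))"
  unfolding det_def by (intro continuous_intros assms)

text \<open>Continuity of the inverse is read off from Cramer's rule.\<close>

lemma continuous_on_matrix_inv:
  fixes Q :: "'a::topological_space \<Rightarrow> real^'n^'n"
  assumes Q: "continuous_on S Q" and inv: "\<And>x. x \<in> S \<Longrightarrow> invertible (Q x)"
  shows "continuous_on S (\<lambda>x. matrix_inv (Q x))"
proof -
  \<comment> \<open>Cramer's numerators: \<open>Q x\<close> with column \<open>k\<close> replaced by
    the \<open>l\<close>-th unit vector.\<close>
  define N where "N x k l = (\<chi> i j. if j = k then axis l 1 $ i else Q x $ i $ j)" for x k l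
  have eq: "matrix_inv (Q x) $ k $ l = det (N x k l) / det (Q x)" if "x \<in> S" for x k l
  proof -
    have "Q x *v (matrix_inv (Q x) *v axis l 1) = axis l 1"
      using invertible_matrix_inv[OF inv[OF that]] by (simp add: matrix_vector_mul_assoc)
    moreover have "det (Q x) \<noteq> 0" using inv[OF that] by (simp add: invertible_det_nz)
    ultimately have "matrix_inv (Q x) *v axis l 1 = (\<chi> k. det (N x k l) / det (Q x))"
      unfolding N_def by (simp add: cramer)
    then have "(matrix_inv (Q x) *v axis l 1) $ k = det (N x k l) / det (Q x)" by simp
    then show ?thesis by (simp add: matrix_vector_mult_basis column_def)
  qed
  have cQ: "continuous_on S (\<lambda>x. Q x $ i $ j)" for i j
    by (intro continuous_on_component Q)
  have c: "continuous_on S (\<lambda>x. det (N x k l) / det (Q x))" for k l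
  proof (intro continuous_on_divide continuous_on_det ballI cQ)
    show "continuous_on S (\<lambda>x. N x k l $ i $ j)" for i j
      unfolding N_def by (cases "j = k") (simp_all add: cQ)
    show "det (Q x) \<noteq> 0" if "x \<in> S" for x
      using inv[OF that] by (simp add: invertible_det_nz)
  qed
  have "continuous_on S (\<lambda>x. \<chi> k l. det (N x k l) / det (Q x))"
    by (intro continuous_on_vec_lambda c)
  then show ?thesis
    by (rule continuous_on_eq) (simp add: vec_eq_iff eq)
qed

section \<open>Quadratic forms on \<open>L\<^sup>2\<close>\<close>

lemma sq_integrable_measurable: "sq_integrable a b f \<Longrightarrow> f \<in> borel_measurable (lebesgue_on {a..b})"
  by (simp add: sq_integrable_def)

lemma norm_add_sq_le: "(norm (x + y))\<^sup>2 \<le> 2 * (norm x)\<^sup>2 + 2 * (norm (y :: 'v::real_inner))\<^sup>2"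
  using zero_le_power2[of "norm (x - y)"]
  by (simp add: power2_norm_eq_inner inner_add inner_diff inner_commute algebra_simps)

lemma sq_integrable_add:
  assumes "sq_integrable a b f" "sq_integrable a b g"
  shows "sq_integrable a b (\<lambda>x. f x + g x)"
  unfolding sq_integrable_def
proof
  show m: "(\<lambda>x. f x + g x) \<in> borel_measurable (lebesgue_on {a..b})"
    using assms by (intro borel_measurable_add) (auto simp: sq_integrable_def)
  show "integrable (lebesgue_on {a..b}) (\<lambda>x. (norm (f x + g x))\<^sup>2)"
  proof (rule Bochner_Integration.integrable_bound)
    show "integrable (lebesgue_on {a..b}) (\<lambda>x. 2 * (norm (f x))\<^sup>2 + 2 * (norm (g x))\<^sup>2)"
      using assms by (simp add: sq_integrable_def)
  qed (use m norm_add_sq_le in \<open>auto intro!: AE_I2 simp: abs_of_nonneg\<close>)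
qed

lemma sq_integrable_scaleR:
  assumes "sq_integrable a b f"
  shows "sq_integrable a b (\<lambda>x. c *\<^sub>R f x)"
  using assms by (auto simp: sq_integrable_def power_mult_distrib)

lemma sq_integrable_diff:
  assumes "sq_integrable a b f" "sq_integrable a b g"
  shows "sq_integrable a b (\<lambda>x. f x - g x)"
  using sq_integrable_add[OF assms(1) sq_integrable_scaleR[OF assms(2), of "-1"]] by simp

text \<open>This rests on the completeness of Lebesgue measure; extension by zero outside
  \<open>S\<close> moves the question to the unrestricted measure.\<close>

lemma borel_measurable_lebesgue_on_AE:
  fixes f g :: "real \<Rightarrow> 'v::euclidean_space"
  assumes f: "f \<in> borel_measurable (lebesgue_on S)" and eq: "AE x in lebesgue_on S. f x = g x"
    and S: "S \<in> sets lebesgue"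
  shows "g \<in> borel_measurable (lebesgue_on S)"
proof -
  have "AE x in lebesgue. x \<in> S \<longrightarrow> f x = g x"
    using eq S by (simp add: AE_restrict_space_iff)
  then have "AE x in lebesgue. (if x \<in> S then f x else 0) = (if x \<in> S then g x else 0)"
    by eventually_elim auto
  moreover have "(\<lambda>x. if x \<in> S then f x else 0) \<in> borel_measurable lebesgue"
    using f S by (simp add: borel_measurable_if)
  ultimately have "(\<lambda>x. if x \<in> S then g x else 0) \<in> borel_measurable lebesgue"
    by (rule borel_measurable_AE[rotated])
  then show ?thesis by (rule borel_measurable_if_D)
qed

lemma sq_integrable_AE:
  fixes f g :: "real \<Rightarrow> 'v::euclidean_space"
  assumes f: "sq_integrable a b f" and eq: "AE x in lebesgue_on {a..b}. f x = g x"
  shows "sq_integrable a b g"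
proof -
  have m: "g \<in> borel_measurable (lebesgue_on {a..b})"
    by (rule borel_measurable_lebesgue_on_AE[OF sq_integrable_measurable[OF f] eq]) simp
  have "integrable (lebesgue_on {a..b}) (\<lambda>x. (norm (g x))\<^sup>2)"
  proof (rule integrable_cong_AE_imp)
    show "integrable (lebesgue_on {a..b}) (\<lambda>x. (norm (f x))\<^sup>2)" using f by (simp add: sq_integrable_def)
    show "AE x in lebesgue_on {a..b}. (norm (f x))\<^sup>2 = (norm (g x))\<^sup>2" using eq by eventually_elim simp
  qed (use m in auto)
  with m show ?thesis by (simp add: sq_integrable_def)
qed

lemma integrable_norm_mult:
  assumes "sq_integrable a b f" "sq_integrable a b g"
  shows "integrable (lebesgue_on {a..b}) (\<lambda>x. norm (f x) * norm (g x))"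
proof (rule Bochner_Integration.integrable_bound)
  show "integrable (lebesgue_on {a..b}) (\<lambda>x. (norm (f x))\<^sup>2 + (norm (g x))\<^sup>2)"
    using assms by (simp add: sq_integrable_def)
  show "(\<lambda>x. norm (f x) * norm (g x)) \<in> borel_measurable (lebesgue_on {a..b})"
    using assms by (auto simp: sq_integrable_def)
  have "p * q \<le> p\<^sup>2 + q\<^sup>2" if "p \<ge> 0" "q \<ge> 0" for p q :: real
    using sum_squares_bound[of p q] mult_nonneg_nonneg[OF that] by simp
  then show "AE x in lebesgue_on {a..b}. norm (norm (f x) * norm (g x)) \<le> norm ((norm (f x))\<^sup>2 + (norm (g x))\<^sup>2)"
    by (intro AE_I2) (simp add: abs_mult)
qed

lemma sq_integrable_const: "sq_integrable a b (\<lambda>x. c)"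
  by (simp add: sq_integrable_def continuous_imp_integrable_real)

lemma sq_integrable_continuous:
  assumes "continuous_on {a..b} f"
  shows "sq_integrable a b f"
  unfolding sq_integrable_def
  using assms by (auto intro!: continuous_imp_measurable_on_sets_lebesgue continuous_imp_integrable_real continuous_intros)

lemma sq_integrable_imp_integrable:
  fixes f :: "real \<Rightarrow> 'v::euclidean_space"
  assumes "sq_integrable a b f"
  shows "integrable (lebesgue_on {a..b}) f"
proof (rule Bochner_Integration.integrable_bound)
  show "integrable (lebesgue_on {a..b}) (\<lambda>x. norm (f x) * norm (1::real))"
    by (rule integrable_norm_mult[OF assms sq_integrable_const])
qed (use assms in \<open>auto simp: sq_integrable_def\<close>)

lemma H1_imp_ac_deriv: "H1_deriv a b f f' \<Longrightarrow> ac_deriv a b f f'"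
  unfolding H1_deriv_def ac_deriv_def using sq_integrable_imp_integrable by blast

lemma l2norm_nonneg: "0 \<le> l2norm a b f"
  by (auto simp: l2norm_def intro!: Bochner_Integration.integral_nonneg)

lemma l2norm_sq: "(l2norm a b f)\<^sup>2 = (LINT x|lebesgue_on {a..b}. (norm (f x))\<^sup>2)"
  by (auto simp: l2norm_def intro!: Bochner_Integration.integral_nonneg)

text \<open>The integral of (norm f + t norm g)^2 is a nonnegative quadratic in t. Keeping the norms
  under the integral lets the estimate bound every form whose integrand is dominated by their
  product.\<close>

lemma l2_Cauchy_Schwarz:
  assumes f: "sq_integrable a b f" and g: "sq_integrable a b g"
  shows "(LINT x|lebesgue_on {a..b}. norm (f x) * norm (g x)) \<le> l2norm a b f * l2norm a b g"
proof -
  let ?I = "LINT x|lebesgue_on {a..b}. norm (f x) * norm (g x)"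
  note i = integrable_norm_mult[OF f g]
  have i2: "integrable (lebesgue_on {a..b}) (\<lambda>x. (norm (f x))\<^sup>2)" "integrable (lebesgue_on {a..b}) (\<lambda>x. (norm (g x))\<^sup>2)"
    using f g by (auto simp: sq_integrable_def)
  have "?I\<^sup>2 \<le> (l2norm a b f)\<^sup>2 * (l2norm a b g)\<^sup>2"
  proof (rule nonneg_quadratic_imp)
    fix t
    have "0 \<le> (LINT x|lebesgue_on {a..b}. (norm (f x) + t * norm (g x))\<^sup>2)"
      by (intro Bochner_Integration.integral_nonneg) simp
    also have "\<dots> = (LINT x|lebesgue_on {a..b}. (norm (f x))\<^sup>2 + (2 * t) * (norm (f x) * norm (g x)) + t\<^sup>2 * (norm (g x))\<^sup>2)"
      by (simp add: power2_eq_square algebra_simps)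
    also have "\<dots> = (l2norm a b f)\<^sup>2 + 2 * t * ?I + t\<^sup>2 * (l2norm a b g)\<^sup>2"
      using i i2 unfolding l2norm_sq by simp
    finally show "0 \<le> (l2norm a b f)\<^sup>2 + 2 * t * ?I + t\<^sup>2 * (l2norm a b g)\<^sup>2" .
  qed simp
  then have "?I\<^sup>2 \<le> (l2norm a b f * l2norm a b g)\<^sup>2" by (simp add: power_mult_distrib)
  then show ?thesis by (rule power2_le_imp_le) (intro mult_nonneg_nonneg l2norm_nonneg)
qed

text \<open>One weighted form covers both functionals: up to the factor 1/2 it is the energy for the
  weight \<open>Q\<close>, and H + \<epsilon> w for the weight \<open>lyap\<close> below. Continuity
  and differentiation in time are then proved once.\<close>

definition l2form :: "real \<Rightarrow> real \<Rightarrow> (real \<Rightarrow> real^'n^'n) \<Rightarrow> (real \<Rightarrow> real^'n) \<Rightarrow> (real \<Rightarrow> real^'n) \<Rightarrow> real" where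
  "l2form a b T f g = (LINT x|lebesgue_on {a..b}. f x \<bullet> (T x *v g x))"

lemma phs_energy_eq_l2form: "phs_energy a b Q z = l2form a b Q z z / 2"
  by (simp add: phs_energy_def l2form_def)

text \<open>\<open>C\<close> is fixed before \<open>f\<close> and \<open>g\<close>, so the bound can
  be used along a whole curve of profiles. It combines a bound of \<open>T\<close> on the compact
  interval with the constant of the matrix-vector product.\<close>

lemma l2form_bound:
  fixes T :: "real \<Rightarrow> real^'n^'n"
  assumes T: "continuous_on {a..b} T"
  obtains C where "C \<ge> 0" and
    "\<And>f g. sq_integrable a b f \<Longrightarrow> sq_integrable a b g \<Longrightarrow>
       integrable (lebesgue_on {a..b}) (\<lambda>x. f x \<bullet> (T x *v g x)) \<and>
       \<bar>l2form a b T f g\<bar> \<le> C * (l2norm a b f * l2norm a b g)"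
proof -
  interpret mv: bounded_bilinear "(*v) :: real^'n^'n \<Rightarrow> real^'n \<Rightarrow> real^'n"
    by (rule bounded_bilinear_matrix_vector_mult)
  obtain D where "D > 0" and D: "\<And>(A::real^'n^'n) y. norm (A *v y) \<le> norm A * norm y * D"
    using mv.pos_bounded by blast
  obtain B where B: "\<And>x. x \<in> {a..b} \<Longrightarrow> norm (T x) \<le> B"
    using compact_continuous_image[OF T] compact_imp_bounded by (force simp: bounded_iff)
  define C where "C = \<bar>B\<bar> * D"
  have "C \<ge> 0" using \<open>D > 0\<close> by (simp add: C_def)
  have bd: "\<bar>f x \<bullet> (T x *v g x)\<bar> \<le> C * (norm (f x) * norm (g x))" if "x \<in> {a..b}" for f g x
  proof -
    have "norm (T x *v g x) \<le> \<bar>B\<bar> * norm (g x) * D"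
      using B[OF that] \<open>D > 0\<close> by (intro order_trans[OF D] mult_right_mono) auto
    then have "norm (f x) * norm (T x *v g x) \<le> norm (f x) * (\<bar>B\<bar> * norm (g x) * D)"
      by (intro mult_left_mono) auto
    then show ?thesis
      using Cauchy_Schwarz_ineq2[of "f x" "T x *v g x"] by (simp add: C_def mult_ac)
  qed
  show ?thesis
  proof (rule that[OF \<open>C \<ge> 0\<close>])
    fix f g :: "real \<Rightarrow> real^'n" assume f: "sq_integrable a b f" and g: "sq_integrable a b g"
    have "(\<lambda>x. T x *v g x) \<in> borel_measurable (lebesgue_on {a..b})"
    proof (rule borel_measurable_bilinear[where h="(*v)"])
      show "bilinear ((*v) :: real^'n^'n \<Rightarrow> real^'n \<Rightarrow> real^'n)"
        using bounded_bilinear_matrix_vector_mult by (simp add: bilinear_conv_bounded_bilinear)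
      show "T \<in> borel_measurable (lebesgue_on {a..b})"
        using T by (simp add: continuous_imp_measurable_on_sets_lebesgue)
    qed (use sq_integrable_measurable[OF g] in auto)
    then have m: "(\<lambda>x. f x \<bullet> (T x *v g x)) \<in> borel_measurable (lebesgue_on {a..b})"
      by (intro borel_measurable_inner sq_integrable_measurable[OF f])
    have iC: "integrable (lebesgue_on {a..b}) (\<lambda>x. C * (norm (f x) * norm (g x)))"
      using integrable_norm_mult[OF f g] by simp
    have i: "integrable (lebesgue_on {a..b}) (\<lambda>x. f x \<bullet> (T x *v g x))"
    proof (rule Bochner_Integration.integrable_bound[OF iC m])
      show "AE x in lebesgue_on {a..b}. norm (f x \<bullet> (T x *v g x)) \<le> norm (C * (norm (f x) * norm (g x)))"
        using bd \<open>C \<ge> 0\<close> by (intro AE_I2) (simp add: abs_mult)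
    qed
    have "\<bar>l2form a b T f g\<bar> \<le> (LINT x|lebesgue_on {a..b}. C * (norm (f x) * norm (g x)))"
      unfolding l2form_def by (rule Bochner_Integration.integral_abs_bound_integral[OF i iC]) (use bd in auto)
    also have "\<dots> = C * (LINT x|lebesgue_on {a..b}. norm (f x) * norm (g x))" by simp
    also have "\<dots> \<le> C * (l2norm a b f * l2norm a b g)"
      using l2_Cauchy_Schwarz[OF f g] \<open>C \<ge> 0\<close> by (rule mult_left_mono)
    finally show "integrable (lebesgue_on {a..b}) (\<lambda>x. f x \<bullet> (T x *v g x)) \<and>
       \<bar>l2form a b T f g\<bar> \<le> C * (l2norm a b f * l2norm a b g)" using i by simp
  qed
qed

lemma l2form_integrable:
  fixes T :: "real \<Rightarrow> real^'n^'n"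
  assumes "continuous_on {a..b} T" "sq_integrable a b f" "sq_integrable a b g"
  shows "integrable (lebesgue_on {a..b}) (\<lambda>x. f x \<bullet> (T x *v g x))"
  using l2form_bound[OF assms(1)] assms(2,3) by metis

text \<open>Symmetry merges the two mixed terms. The case c = 1 gives continuity of the form, and c
  = s - t its derivative in time.\<close>

lemma l2form_expand:
  fixes T :: "real \<Rightarrow> real^'n^'n"
  assumes T: "continuous_on {a..b} T" and sym: "\<And>x. x \<in> {a..b} \<Longrightarrow> transpose (T x) = T x"
    and z: "sq_integrable a b z" and u: "sq_integrable a b u"
  shows "l2form a b T (\<lambda>x. z x + c *\<^sub>R u x) (\<lambda>x. z x + c *\<^sub>R u x) =
    l2form a b T z z + 2 * c * l2form a b T z u + c\<^sup>2 * l2form a b T u u"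
proof -
  interpret mv: bounded_bilinear "(*v) :: real^'n^'n \<Rightarrow> real^'n \<Rightarrow> real^'n"
    by (rule bounded_bilinear_matrix_vector_mult)
  note i = l2form_integrable[OF T z z] l2form_integrable[OF T z u] l2form_integrable[OF T u u]
  have "l2form a b T (\<lambda>x. z x + c *\<^sub>R u x) (\<lambda>x. z x + c *\<^sub>R u x) =
    (LINT x|lebesgue_on {a..b}. z x \<bullet> (T x *v z x) + (2 * c) * (z x \<bullet> (T x *v u x)) + c\<^sup>2 * (u x \<bullet> (T x *v u x)))"
    unfolding l2form_def
  proof (rule Bochner_Integration.integral_cong)
    fix x assume "x \<in> space (lebesgue_on {a..b})"
    then have "u x \<bullet> (T x *v z x) = z x \<bullet> (T x *v u x)"
      using inner_matrix_symmetric[OF sym, of x "u x" "z x"] by (simp add: inner_commute)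
    then show "(z x + c *\<^sub>R u x) \<bullet> (T x *v (z x + c *\<^sub>R u x)) =
      z x \<bullet> (T x *v z x) + (2 * c) * (z x \<bullet> (T x *v u x)) + c\<^sup>2 * (u x \<bullet> (T x *v u x))"
      by (simp add: mv.add_right mv.scaleR_right inner_add_left inner_add_right power2_eq_square algebra_simps)
  qed simp
  also have "\<dots> = l2form a b T z z + 2 * c * l2form a b T z u + c\<^sup>2 * l2form a b T u u"
    using i unfolding l2form_def by simp
  finally show ?thesis .
qed

lemma l2form_add_right:
  fixes T :: "real \<Rightarrow> real^'n^'n"
  assumes T: "continuous_on {a..b} T"
    and f: "sq_integrable a b f" and g: "sq_integrable a b g" and h: "sq_integrable a b h"
  shows "l2form a b T f (\<lambda>x. g x + h x) = l2form a b T f g + l2form a b T f h"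
  using l2form_integrable[OF T f g] l2form_integrable[OF T f h]
  by (simp add: l2form_def matrix_vector_right_distrib inner_add_right)

lemma l2norm_scaleR_sq: "(l2norm a b (\<lambda>x. c *\<^sub>R f x))\<^sup>2 = c\<^sup>2 * (l2norm a b f)\<^sup>2"
  unfolding l2norm_sq by (simp add: power_mult_distrib)

text \<open>A substitute for the triangle inequality; the factor 2 is harmless because the summands
  it is applied to stay bounded or tend to 0.\<close>

lemma l2norm_add_sq_le:
  fixes f g :: "real \<Rightarrow> 'v::euclidean_space"
  assumes f: "sq_integrable a b f" and g: "sq_integrable a b g"
  shows "(l2norm a b (\<lambda>x. f x + g x))\<^sup>2 \<le> 2 * (l2norm a b f)\<^sup>2 + 2 * (l2norm a b g)\<^sup>2"
proof -
  have i: "integrable (lebesgue_on {a..b}) (\<lambda>x. (norm (f x))\<^sup>2)" "integrable (lebesgue_on {a..b}) (\<lambda>x. (norm (g x))\<^sup>2)"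
    "integrable (lebesgue_on {a..b}) (\<lambda>x. (norm (f x + g x))\<^sup>2)"
    using f g sq_integrable_add[OF f g] by (auto simp: sq_integrable_def)
  have "(l2norm a b (\<lambda>x. f x + g x))\<^sup>2 \<le> (LINT x|lebesgue_on {a..b}. 2 * (norm (f x))\<^sup>2 + 2 * (norm (g x))\<^sup>2)"
    unfolding l2norm_sq using i by (intro integral_mono norm_add_sq_le) auto
  also have "\<dots> = 2 * (l2norm a b f)\<^sup>2 + 2 * (l2norm a b g)\<^sup>2"
    unfolding l2norm_sq using i by simp
  finally show ?thesis .
qed

lemma l2form_tendsto:
  fixes T :: "real \<Rightarrow> real^'n^'n" and w :: "'b \<Rightarrow> real \<Rightarrow> real^'n"
  assumes T: "continuous_on {a..b} T" and sym: "\<And>x. x \<in> {a..b} \<Longrightarrow> transpose (T x) = T x"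
    and z: "sq_integrable a b z" and w: "\<forall>\<^sub>F h in F. sq_integrable a b (w h)"
    and lim: "((\<lambda>h. l2norm a b (\<lambda>x. w h x - z x)) \<longlongrightarrow> 0) F"
  shows "((\<lambda>h. l2form a b T (w h) (w h)) \<longlongrightarrow> l2form a b T z z) F"
proof -
  obtain C where C: "C \<ge> 0" "\<And>f g. sq_integrable a b f \<Longrightarrow> sq_integrable a b g \<Longrightarrow>
       \<bar>l2form a b T f g\<bar> \<le> C * (l2norm a b f * l2norm a b g)"
    using l2form_bound[OF T] by metis
  let ?r = "\<lambda>h. l2norm a b (\<lambda>x. w h x - z x)"
  have "((\<lambda>h. l2form a b T (w h) (w h) - l2form a b T z z) \<longlongrightarrow> 0) F"
  proof (rule Lim_null_comparison)
    show "\<forall>\<^sub>F h in F. norm (l2form a b T (w h) (w h) - l2form a b T z z)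
      \<le> 2 * (C * (l2norm a b z * ?r h)) + C * (?r h * ?r h)"
      using w
    proof eventually_elim
      case (elim h)
      define r where "r x = w h x - z x" for x
      have r: "sq_integrable a b r" unfolding r_def by (rule sq_integrable_diff[OF elim z])
      have "l2form a b T (w h) (w h) = l2form a b T z z + 2 * l2form a b T z r + l2form a b T r r"
        using l2form_expand[OF T sym z r, of 1] by (simp add: r_def)
      moreover have "\<bar>l2form a b T z r\<bar> \<le> C * (l2norm a b z * l2norm a b r)"
        "\<bar>l2form a b T r r\<bar> \<le> C * (l2norm a b r * l2norm a b r)"
        using C(2) z r by auto
      ultimately show ?case by (simp add: r_def[abs_def])
    qed
    have "((\<lambda>h. 2 * (C * (l2norm a b z * ?r h)) + C * (?r h * ?r h)) \<longlongrightarrow> 2 * (C * (l2norm a b z * 0)) + C * (0 * 0)) F"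
      by (intro tendsto_intros lim)
    then show "((\<lambda>h. 2 * (C * (l2norm a b z * ?r h)) + C * (?r h * ?r h)) \<longlongrightarrow> 0) F" by simp
  qed
  then show ?thesis by (simp add: LIM_zero_iff)
qed

text \<open>Write z s = z t + (s - t) (g + r s) with r s tending to 0 in L2. The quadratic expansion
  leaves one error linear in r s and one with the factor s - t; both vanish in the limit by
  \<open>l2form_bound\<close>.\<close>

lemma l2form_has_derivative:
  fixes T :: "real \<Rightarrow> real^'n^'n" and z :: "real \<Rightarrow> real \<Rightarrow> real^'n"
  assumes T: "continuous_on {a..b} T" and sym: "\<And>x. x \<in> {a..b} \<Longrightarrow> transpose (T x) = T x"
    and z: "\<And>s. s \<ge> 0 \<Longrightarrow> sq_integrable a b (z s)" and g: "sq_integrable a b g"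
    and d: "has_L2_deriv a b z g t" and t: "t \<ge> 0"
  shows "((\<lambda>s. l2form a b T (z s) (z s)) has_real_derivative 2 * l2form a b T (z t) g) (at t within {0..})"
proof -
  obtain C where C: "C \<ge> 0" "\<And>f g. sq_integrable a b f \<Longrightarrow> sq_integrable a b g \<Longrightarrow>
       \<bar>l2form a b T f g\<bar> \<le> C * (l2norm a b f * l2norm a b g)"
    using l2form_bound[OF T] by metis
  define \<phi> where "\<phi> s = l2form a b T (z s) (z s)" for s
  define r where "r s x = (z s x - z t x) /\<^sub>R (s - t) - g x" for s x
  define \<rho> where "\<rho> s = l2norm a b (r s)" for s
  have \<rho>: "(\<rho> \<longlongrightarrow> 0) (at t within {0..})"
    using d unfolding has_L2_deriv_def \<rho>_def r_def by simp
  have "((\<lambda>s. (\<phi> s - \<phi> t) / (s - t) - 2 * l2form a b T (z t) g) \<longlongrightarrow> 0) (at t within {0..})"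
  proof (rule Lim_null_comparison)
    let ?B = "\<lambda>s. 2 * (C * (l2norm a b (z t) * \<rho> s)) + \<bar>s - t\<bar> * (C * (2 * (l2norm a b g)\<^sup>2 + 2 * (\<rho> s)\<^sup>2))"
    show "\<forall>\<^sub>F s in at t within {0..}. norm ((\<phi> s - \<phi> t) / (s - t) - 2 * l2form a b T (z t) g) \<le> ?B s"
      unfolding eventually_at_filter
    proof (intro always_eventually allI impI)
      fix s assume "s \<noteq> t" "s \<in> {0..}"
      then have zs: "sq_integrable a b (z s)" and zt: "sq_integrable a b (z t)" using z t by auto
      have r: "sq_integrable a b (r s)"
        unfolding r_def by (intro sq_integrable_diff sq_integrable_scaleR zs zt g)
      define u where "u x = g x + r s x" for x
      have u: "sq_integrable a b u" unfolding u_def by (rule sq_integrable_add[OF g r])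
      have "z s = (\<lambda>x. z t x + (s - t) *\<^sub>R u x)"
        using \<open>s \<noteq> t\<close> by (auto simp: u_def r_def)
      then have "\<phi> s = \<phi> t + 2 * (s - t) * l2form a b T (z t) u + (s - t)\<^sup>2 * l2form a b T u u"
        using l2form_expand[OF T sym zt u, of "s - t"] by (simp add: \<phi>_def)
      then have "(\<phi> s - \<phi> t) / (s - t) = 2 * l2form a b T (z t) u + (s - t) * l2form a b T u u"
        using \<open>s \<noteq> t\<close> by (simp add: field_simps power2_eq_square)
      also have "l2form a b T (z t) u = l2form a b T (z t) g + l2form a b T (z t) (r s)"
        unfolding u_def by (rule l2form_add_right[OF T zt g r])
      finally have eq: "(\<phi> s - \<phi> t) / (s - t) - 2 * l2form a b T (z t) g =
          2 * l2form a b T (z t) (r s) + (s - t) * l2form a b T u u" by simp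
      have "\<bar>l2form a b T u u\<bar> \<le> C * (l2norm a b u)\<^sup>2"
        using C(2)[OF u u] by (simp add: power2_eq_square)
      also have "\<dots> \<le> C * (2 * (l2norm a b g)\<^sup>2 + 2 * (\<rho> s)\<^sup>2)"
        unfolding u_def \<rho>_def using C(1) by (intro mult_left_mono l2norm_add_sq_le g r)
      finally have "\<bar>s - t\<bar> * \<bar>l2form a b T u u\<bar> \<le> \<bar>s - t\<bar> * (C * (2 * (l2norm a b g)\<^sup>2 + 2 * (\<rho> s)\<^sup>2))"
        by (intro mult_left_mono) auto
      moreover have "\<bar>l2form a b T (z t) (r s)\<bar> \<le> C * (l2norm a b (z t) * \<rho> s)"
        unfolding \<rho>_def by (rule C(2)[OF zt r])
      ultimately show "norm ((\<phi> s - \<phi> t) / (s - t) - 2 * l2form a b T (z t) g) \<le> ?B s"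
        unfolding eq real_norm_def
        using abs_triangle_ineq[of "2 * l2form a b T (z t) (r s)" "(s - t) * l2form a b T u u"]
        by (simp add: abs_mult)
    qed
    have "(?B \<longlongrightarrow> 2 * (C * (l2norm a b (z t) * 0)) + \<bar>t - t\<bar> * (C * (2 * (l2norm a b g)\<^sup>2 + 2 * 0\<^sup>2))) (at t within {0..})"
      by (intro tendsto_intros \<rho>)
    then show "(?B \<longlongrightarrow> 0) (at t within {0..})" by simp
  qed
  then have "((\<lambda>s. (\<phi> s - \<phi> t) / (s - t)) \<longlongrightarrow> 2 * l2form a b T (z t) g) (at t within {0..})"
    by (simp add: LIM_zero_iff)
  then show ?thesis by (simp add: has_field_derivative_iff \<phi>_def)
qed

section \<open>The weighted energy balance\<close>

lemma H1_deriv_scaleR_diff: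
  fixes f f' g g' :: "real \<Rightarrow> 'v::euclidean_space"
  assumes f: "H1_deriv a b f f'" and g: "H1_deriv a b g g'"
  shows "H1_deriv a b (\<lambda>x. c *\<^sub>R (f x - g x)) (\<lambda>x. c *\<^sub>R (f' x - g' x))"
  unfolding H1_deriv_def
proof (intro conjI ballI)
  have s: "sq_integrable a b f'" "sq_integrable a b g'" using f g unfolding H1_deriv_def by blast+
  then show "sq_integrable a b (\<lambda>x. c *\<^sub>R (f' x - g' x))"
    by (intro sq_integrable_scaleR sq_integrable_diff)
  fix x assume x: "x \<in> {a..b}"
  then have "{a..x} \<subseteq> {a..b}" by auto
  note i = s[THEN sq_integrable_imp_integrable, THEN integrable_subinterval, OF this]
  have "f x = f a + (LINT y|lebesgue_on {a..x}. f' y)" "g x = g a + (LINT y|lebesgue_on {a..x}. g' y)"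
    using f g x unfolding H1_deriv_def by blast+
  moreover have "(LINT y|lebesgue_on {a..x}. c *\<^sub>R (f' y - g' y)) =
     c *\<^sub>R ((LINT y|lebesgue_on {a..x}. f' y) - (LINT y|lebesgue_on {a..x}. g' y))"
    using i by simp
  ultimately show "c *\<^sub>R (f x - g x) = c *\<^sub>R (f a - g a) + (LINT y|lebesgue_on {a..x}. c *\<^sub>R (f' y - g' y))"
    by (simp add: scaleR_right_diff_distrib scaleR_right_distrib del: Bochner_Integration.integral_scaleR_right)
qed

text \<open>Equation and boundary conditions are linear in the pair e, e'. This particular
  combination is the one that occurs in difference quotients in time.\<close>

lemma phs_op_scaleR_diff:
  assumes "phs_op a b P1 P0 G0 Q W1 W1t W2 K z1 g1" "phs_op a b P1 P0 G0 Q W1 W1t W2 K z2 g2"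
  shows "phs_op a b P1 P0 G0 Q W1 W1t W2 K (\<lambda>x. c *\<^sub>R (z1 x - z2 x)) (\<lambda>x. c *\<^sub>R (g1 x - g2 x))"
proof -
  note lin = matrix_vector_mult_scaleR matrix_vector_mult_diff_distrib
  obtain e1 e1' where 1: "H1_deriv a b e1 e1'" "AE x in lebesgue_on {a..b}. e1 x = Q x *v z1 x"
    "W2 *v e1 a = 0" "W1 *v e1 b + K *v (W1t *v e1 b) = 0"
    "AE x in lebesgue_on {a..b}. g1 x = P1 *v e1' x + (P0 - G0) *v e1 x"
    using assms(1) unfolding phs_op_def by blast
  obtain e2 e2' where 2: "H1_deriv a b e2 e2'" "AE x in lebesgue_on {a..b}. e2 x = Q x *v z2 x"
    "W2 *v e2 a = 0" "W1 *v e2 b + K *v (W1t *v e2 b) = 0"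
    "AE x in lebesgue_on {a..b}. g2 x = P1 *v e2' x + (P0 - G0) *v e2 x"
    using assms(2) unfolding phs_op_def by blast
  have bc: "W1 *v (c *\<^sub>R (e1 b - e2 b)) + K *v (W1t *v (c *\<^sub>R (e1 b - e2 b))) = 0"
  proof -
    have "W1 *v (c *\<^sub>R (e1 b - e2 b)) + K *v (W1t *v (c *\<^sub>R (e1 b - e2 b))) =
      c *\<^sub>R ((W1 *v e1 b + K *v (W1t *v e1 b)) - (W1 *v e2 b + K *v (W1t *v e2 b)))"
      by (simp add: lin algebra_simps)
    then show ?thesis using 1(4) 2(4) by simp
  qed
  show ?thesis unfolding phs_op_def
  proof (rule conjI[rotated], rule exI[of _ "\<lambda>x. c *\<^sub>R (e1 x - e2 x)"],
      rule exI[of _ "\<lambda>x. c *\<^sub>R (e1' x - e2' x)"], intro conjI)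
    show "sq_integrable a b (\<lambda>x. c *\<^sub>R (z1 x - z2 x))"
      using assms unfolding phs_op_def by (intro sq_integrable_scaleR sq_integrable_diff) auto
    show "H1_deriv a b (\<lambda>x. c *\<^sub>R (e1 x - e2 x)) (\<lambda>x. c *\<^sub>R (e1' x - e2' x))"
      by (rule H1_deriv_scaleR_diff[OF 1(1) 2(1)])
    show "AE x in lebesgue_on {a..b}. c *\<^sub>R (e1 x - e2 x) = Q x *v (c *\<^sub>R (z1 x - z2 x))"
      using 1(2) 2(2) by eventually_elim (simp add: lin)
    show "AE x in lebesgue_on {a..b}. c *\<^sub>R (g1 x - g2 x) =
       P1 *v (c *\<^sub>R (e1' x - e2' x)) + (P0 - G0) *v (c *\<^sub>R (e1 x - e2 x))"
      using 1(5) 2(5) by eventually_elim (simp add: lin scaleR_right_diff_distrib scaleR_right_distrib)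
  qed (use 1(3) 2(3) bc in \<open>simp_all add: lin\<close>)
qed

section \<open>The sign of the multiplier\<close>

lemma ac_deriv_C1:
  fixes m m' :: "real \<Rightarrow> real"
  assumes d: "\<And>x. x \<in> {a..b} \<Longrightarrow> (m has_real_derivative m' x) (at x within {a..b})"
    and c: "continuous_on {a..b} m'"
  shows "ac_deriv a b m m'"
  unfolding ac_deriv_def
proof (intro conjI ballI)
  show i: "integrable (lebesgue_on {a..b}) m'" by (rule continuous_imp_integrable_real[OF c])
  fix x assume x: "x \<in> {a..b}"
  have "(m' has_integral (m x - m a)) {a..x}"
  proof (rule fundamental_theorem_of_calculus)
    fix y assume "y \<in> {a..x}"
    then have "(m has_real_derivative m' y) (at y within {a..x})"
      using x by (intro DERIV_subset[OF d]) auto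
    then show "(m has_vector_derivative m' y) (at y within {a..x})"
      by (simp add: has_real_derivative_iff_has_vector_derivative)
  qed (use x in auto)
  moreover have "integrable (lebesgue_on {a..x}) m'"
    by (rule integrable_subinterval[OF i]) (use x in auto)
  ultimately show "m x = m a + (LINT y|lebesgue_on {a..x}. m' y)"
    by (simp add: lebesgue_integral_eq_integral integral_unique)
qed

text \<open>Just after its last zero, a negative \<open>m\<close> would attain a minimum \<open>m w < 0\<close> on an interval with
  \<open>\<integral>\<bar>\<beta>\<bar> < 1\<close>, but there \<open>m w \<ge> m w \<integral>\<bar>\<beta>\<bar>\<close>.\<close>

lemma ac_deriv_nonneg:
  fixes m m' \<beta> :: "real \<Rightarrow> real"
  assumes m: "ac_deriv a b m m'" and ma: "0 \<le> m a"
    and \<beta>: "integrable (lebesgue_on {a..b}) \<beta>"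
    and ineq: "AE x in lebesgue_on {a..b}. m x * \<beta> x \<le> m' x"
    and x: "x \<in> {a..b}"
  shows "0 \<le> m x"
proof (rule ccontr)
  assume "\<not> 0 \<le> m x"
  then have neg: "m x < 0" by simp
  have cm: "continuous_on {u..v} m" if "a \<le> u" "v \<le> b" for u v
    using ac_deriv_continuous[OF m] by (rule continuous_on_subset) (use that in auto)
  \<comment> \<open>The zeros of \<open>m\<close> on [a,x] form a nonempty compact set by the
    intermediate value theorem; after the largest one \<open>m\<close> stays negative up to
    \<open>x\<close>.\<close>
  define S where "S = {a..x} \<inter> m -` {0}"
  have "compact S"
    unfolding S_def compact_eq_bounded_closed
    using x by (intro conjI continuous_closed_preimage cm bounded_Int) auto
  moreover have "S \<noteq> {}"
    using IVT2'[of m x 0 a] neg ma x cm[of a x] unfolding S_def by fastforce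
  ultimately obtain x1 where x1: "x1 \<in> S" and x1max: "\<And>s. s \<in> S \<Longrightarrow> s \<le> x1"
    using compact_attains_sup[of S] by metis
  have x1': "a \<le> x1" "x1 < x" "m x1 = 0"
    using x1 neg by (auto simp: S_def le_less)
  have neg1: "m y < 0" if y: "x1 < y" "y \<le> x" for y
  proof (rule ccontr)
    assume "\<not> m y < 0"
    then obtain s where "y \<le> s" "s \<le> x" "m s = 0"
      using IVT2'[of m x 0 y] neg y x x1' cm[of y x] by auto
    then show False using x1max[of s] y x1' by (auto simp: S_def)
  qed
  have sub: "{x1..x} \<subseteq> {a..b}" using x1' x by auto
  have ib: "integrable (lebesgue_on {x1..x}) (\<lambda>y. \<bar>\<beta> y\<bar>)"
    using integrable_subinterval[OF \<beta> sub] by simp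
  define J where "J y = (LINT s|lebesgue_on {x1..y}. \<bar>\<beta> s\<bar>)" for y
  have "continuous_on {x1..x} J"
    unfolding J_def by (rule indefinite_integral_continuous_real[OF ib])
  moreover have "J x1 = 0"
  proof -
    have "{x1} \<in> null_sets lebesgue" by (metis negligible_iff_null_sets negligible_sing)
    then show ?thesis unfolding J_def by (simp add: integral_eq_zero_null_sets)
  qed
  ultimately obtain d where "d > 0" and d: "\<And>s. s \<in> {x1..x} \<Longrightarrow> \<bar>s - x1\<bar> < d \<Longrightarrow> \<bar>J s\<bar> < 1/2"
    using x1' unfolding continuous_on_iff dist_real_def
    by (metis atLeastAtMost_iff diff_zero half_gt_zero_iff less_imp_le order_refl zero_less_one)
  \<comment> \<open>Half of \<open>d\<close> keeps [x1,y] strictly inside the range where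
    \<open>J\<close> is below 1/2.\<close>
  define y where "y = min x (x1 + d / 2)"
  have y: "x1 < y" "y \<le> x" "y < x1 + d" using \<open>d > 0\<close> x1' by (auto simp: y_def)
  obtain w where w: "w \<in> {x1..y}" and wmin: "\<And>s. s \<in> {x1..y} \<Longrightarrow> m w \<le> m s"
    using continuous_attains_inf[OF compact_Icc _ cm[of x1 y]] x1' y x by auto
  have "m w < 0" using wmin[of y] neg1[of y] y by auto
  have w': "x1 \<le> w" "w \<le> y" "w \<le> b" using w y x by auto
  have subw: "{x1..w} \<subseteq> {a..b}" using w' x1' by auto
  have im: "integrable (lebesgue_on {x1..w}) m'"
    by (rule integrable_subinterval[OF ac_deriv_integrable[OF m] subw])
  have ibw: "integrable (lebesgue_on {x1..w}) (\<lambda>s. \<bar>\<beta> s\<bar>)"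
    using integrable_subinterval[OF \<beta> subw] by simp
  have "AE s in lebesgue. s \<in> {a..b} \<longrightarrow> m s * \<beta> s \<le> m' s"
    using ineq by (simp add: AE_restrict_space_iff)
  then have "AE s in lebesgue_on {x1..w}. m s * \<beta> s \<le> m' s"
    using subw by (subst AE_restrict_space_iff) (auto elim!: eventually_mono)
  then have "AE s in lebesgue_on {x1..w}. m w * \<bar>\<beta> s\<bar> \<le> m' s"
  proof (rule lebesgue_on_mono)
    fix s assume s: "m s * \<beta> s \<le> m' s" "s \<in> {x1..w}"
    have "m w \<le> m s" "m s \<le> 0"
      using s w' wmin[of s] neg1[of s] y x1' by (auto simp: le_less)
    \<comment> \<open>The first inequality holds because m w is the minimum, the second because m s
      \<le> 0 reverses \<beta> \<le> \<bar>\<beta>\<bar>.\<close>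
    have "m w * \<bar>\<beta> s\<bar> \<le> m s * \<bar>\<beta> s\<bar>"
      using \<open>m w \<le> m s\<close> by (intro mult_right_mono) auto
    also have "\<dots> \<le> m s * \<beta> s"
      using \<open>m s \<le> 0\<close> by (intro mult_left_mono_neg) auto
    finally show "m w * \<bar>\<beta> s\<bar> \<le> m' s" using s by simp
  qed
  then have "(LINT s|lebesgue_on {x1..w}. m w * \<bar>\<beta> s\<bar>) \<le> (LINT s|lebesgue_on {x1..w}. m' s)"
    using ibw im by (intro integral_mono_AE) auto
  moreover have "m w - m x1 = (LINT s|lebesgue_on {x1..w}. m' s)"
    by (rule ac_deriv_diff[OF m]) (use w' x1' in auto)
  \<comment> \<open>Divided by the negative \<open>m w\<close>, this says J w \<ge> 1, against the
    choice of \<open>d\<close>.\<close>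
  ultimately have "m w * J w \<le> m w" using x1' by (simp add: J_def)
  moreover have "J w < 1" using d[of w] w' y by auto
  then have "m w * 1 < m w * J w" using \<open>m w < 0\<close> by (rule mult_strict_left_mono_neg)
  ultimately show False by simp
qed

section \<open>Stacked boundary matrices and the pointwise estimate\<close>

lemma vblock_mult_nth:
  "(vblock A B *v v) $ Inl j = (A *v v) $ j" "(vblock A B *v v) $ Inr i = (B *v v) $ i"
  by (simp_all add: vblock_def matrix_vector_mult_def)

lemma vblock_mult_eqI:
  assumes "A *v v = C *v w" "B *v v = D *v w"
  shows "vblock A B *v v = vblock C D *v w"
  unfolding vec_eq_iff
proof
  fix i show "(vblock A B *v v) $ i = (vblock C D *v w) $ i"
    by (cases i) (simp_all add: vblock_mult_nth assms)
qed

lemma inner_transpose_mult: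
  fixes A :: "real^'n^'m"
  shows "x \<bullet> (transpose A *v y) = (A *v x) \<bullet> y"
  by (metis dot_lmul_matrix inner_commute transpose_matrix_vector)

text \<open>If \<open>y\<close> is the output at \<open>b\<close>, the vector on both sides of the
  inverse of \<open>Q\<close> is the boundary value of Q z recovered from the input - K y and the
  output y. At x = b the form is then the density z \<bullet> Q z.\<close>

lemma Psi_mat_form:
  "y \<bullet> (Psi_mat Q W1 W1t K x *v y) =
    (matrix_inv (vblock W1 W1t) *v (vblock (- K) (mat 1) *v y)) \<bullet>
     (matrix_inv (Q x) *v (matrix_inv (vblock W1 W1t) *v (vblock (- K) (mat 1) *v y)))"
  unfolding Psi_mat_def
  by (simp only: matrix_vector_mul_assoc[symmetric] inner_transpose_mult)

lemma transpose_Psi_mat: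
  assumes "transpose (matrix_inv (Q x)) = matrix_inv (Q x)"
  shows "transpose (Psi_mat Q W1 W1t K x) = Psi_mat Q W1 W1t K x"
  unfolding Psi_mat_def by (simp add: matrix_transpose_mul assms matrix_mul_assoc)

lemma transpose_add_matrix: "transpose (A + B) = transpose A + transpose B"
  by (simp add: transpose_def vec_eq_iff)

text \<open>The difference of the two sides is \<open>e \<bullet> G0 e + \<epsilon>/2 (z \<bullet> A\<^sub>s z - c z \<bullet> Q z)\<close>.\<close>

lemma dissipation_pointwise:
  fixes P1 P0 G0 :: "real^'n^'n" and Q Q' :: "real \<Rightarrow> real^'n^'n" and e' z :: "real^'n"
  assumes P1: "transpose P1 = P1" "invertible P1" and P0: "transpose P0 = - P0" and G0: "pos_semidef G0"
    and Q: "pos_def (Q x)" and \<epsilon>: "\<epsilon> \<ge> 0"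
    and As: "pos_semidef (As_mat P1 P0 G0 Q Q' m m' x - c *\<^sub>R Q x)"
    and e: "e = Q x *v z" and g: "g = P1 *v e' + (P0 - G0) *v e"
    and z': "z' = matrix_inv (Q x) *v (e' - Q' x *v z)"
  shows "z \<bullet> ((Q x + (\<epsilon> * m x) *\<^sub>R matrix_inv P1) *v g) \<le>
    1/2 * (e' \<bullet> (P1 *v e) + e \<bullet> (P1 *v e')) + \<epsilon>/2 * (m' x * (z \<bullet> e) + m x * (z' \<bullet> e + z \<bullet> e'))
    - \<epsilon> * c / 2 * (z \<bullet> (Q x *v z))"
proof -
  let ?Pi = "matrix_inv P1" and ?R = "matrix_inv (Q x)"
  note mv = matrix_vector_mult_add_rdistrib matrix_vector_mult_diff_rdistrib
    matrix_vector_right_distrib matrix_vector_mult_diff_distrib matrix_vector_mul_assoc[symmetric]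
    scaleR_matrix_vector_assoc[symmetric]
  have Qs: "transpose (Q x) = Q x" and iQ: "invertible (Q x)"
    using Q pos_def_invertible by (auto simp: pos_def_def)
  have Pis: "transpose ?Pi = ?Pi" by (rule transpose_matrix_inv[OF P1])
  have Rs: "transpose ?R = ?R" by (rule transpose_matrix_inv[OF Qs iQ])
  have PiP: "?Pi *v (P1 *v v) = v" for v
    using invertible_matrix_inv[OF P1(2)] by (simp add: matrix_vector_mul_assoc)
  have RQ: "?R *v (Q x *v v) = v" for v
    using invertible_matrix_inv[OF iQ] by (simp add: matrix_vector_mul_assoc)
  have G0s: "transpose G0 = G0" using G0 by (simp add: pos_semidef_def)
  interpret bl: bounded_bilinear "(*v) :: real^'n^'n \<Rightarrow> real^'n \<Rightarrow> real^'n"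
    by (rule bounded_bilinear_matrix_vector_mult)
  have skew: "e \<bullet> (P0 *v e) = 0"
  proof -
    have "e \<bullet> (transpose P0 *v e) = (P0 *v e) \<bullet> e" by (rule inner_transpose_mult)
    then show ?thesis unfolding P0 by (simp add: bl.minus_left inner_commute)
  qed
  have sQ: "z \<bullet> (Q x *v g) = e \<bullet> g"
    using inner_matrix_symmetric[OF Qs] by (simp add: e)
  have sP: "e' \<bullet> (P1 *v e) = e \<bullet> (P1 *v e')"
    using inner_matrix_symmetric[OF P1(1), of e' e] by (simp add: inner_commute)
  have z'e: "z' \<bullet> e = z \<bullet> e' - z \<bullet> (Q' x *v z)"
  proof -
    have "z' \<bullet> e = (e' - Q' x *v z) \<bullet> z"
      using inner_matrix_symmetric[OF Rs, of "e' - Q' x *v z" e] by (simp only: z' e RQ)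
    then show ?thesis by (simp add: inner_diff_left inner_diff_right inner_commute)
  qed
  \<comment> \<open>Transposition exchanges P0 + G0 with - (P0 - G0). Hence the two zero-order terms
    of \<open>B_mat\<close> contribute equally to the quadratic form, which is the source of the
    factor 2 below.\<close>
  have tr: "z \<bullet> (Q x *v ((P0 + G0) *v (?Pi *v z))) = - (z \<bullet> (?Pi *v ((P0 - G0) *v e)))"
  proof -
    have "z \<bullet> (Q x *v ((P0 + G0) *v (?Pi *v z))) = e \<bullet> ((P0 + G0) *v (?Pi *v z))"
      using inner_matrix_symmetric[OF Qs] by (simp add: e)
    also have "\<dots> = (transpose (P0 + G0) *v e) \<bullet> (?Pi *v z)"
      by (metis inner_transpose_mult transpose_transpose)
    also have "\<dots> = (?Pi *v (transpose (P0 + G0) *v e)) \<bullet> z"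
      by (rule inner_matrix_symmetric[OF Pis])
    also have "transpose (P0 + G0) = - (P0 - G0)"
      by (simp add: transpose_add_matrix P0 G0s)
    finally show ?thesis
      by (simp add: inner_commute bl.minus_left bl.minus_right del: minus_diff_eq)
  qed
  have "0 \<le> z \<bullet> ((As_mat P1 P0 G0 Q Q' m m' x - c *\<^sub>R Q x) *v z)"
    using As unfolding pos_semidef_def by blast
  also have "\<dots> = m' x * (z \<bullet> e) - m x * (z \<bullet> (Q' x *v z) -
      z \<bullet> (Q x *v ((P0 + G0) *v (?Pi *v z))) + z \<bullet> (?Pi *v ((P0 - G0) *v e))) - c * (z \<bullet> e)"
    unfolding As_mat_def B_mat_def mv e[symmetric]
    by (simp add: inner_add_right inner_diff_right algebra_simps)
  also have "\<dots> = m' x * (z \<bullet> e) - m x * (z \<bullet> (Q' x *v z) + 2 * (z \<bullet> (?Pi *v ((P0 - G0) *v e)))) - c * (z \<bullet> e)"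
    unfolding tr by simp
  finally have "0 \<le> \<epsilon>/2 * (m' x * (z \<bullet> e) - m x * (z \<bullet> (Q' x *v z) + 2 * (z \<bullet> (?Pi *v ((P0 - G0) *v e)))) - c * (z \<bullet> e))"
    using \<epsilon> by simp
  moreover have "z \<bullet> ((Q x + (\<epsilon> * m x) *\<^sub>R ?Pi) *v g) = e \<bullet> g + \<epsilon> * m x * (z \<bullet> (?Pi *v g))"
    by (simp add: mv sQ inner_add_right)
  moreover have "e \<bullet> g = e \<bullet> (P1 *v e') - e \<bullet> (G0 *v e)"
    by (simp add: g mv inner_add_right inner_diff_right skew)
  moreover have "?Pi *v g = e' + ?Pi *v ((P0 - G0) *v e)"
    by (simp add: g matrix_vector_right_distrib PiP)
  moreover have "0 \<le> e \<bullet> (G0 *v e)" using G0 by (simp add: pos_semidef_def)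
  ultimately show ?thesis
    by (simp add: sP z'e e[symmetric] inner_add_right algebra_simps)
qed

lemma bounded_bilinear_matrix_form:
  "bounded_bilinear (\<lambda>x y. x \<bullet> (A *v y))" for A :: "real^'n^'n"
  using bounded_bilinear.comp[OF bounded_bilinear_inner bounded_linear_ident matrix_vector_mul_bounded_linear] .

text \<open>Only the system and the multiplier are fixed here. The conditions on \<epsilon> enter
  the decay lemmas as two inequalities, \<open>bdry\<close> (later supplied by \<open>eps1\<close>)
  and \<open>bound\<close> (supplied by \<open>eps0\<close>), which keeps eigenvalues out of the
  dynamical argument.\<close>

locale boundary_damped_phs =
  fixes a b :: real
    and P1 P0 G0 :: "real^'n^'n"
    and Q Q' :: "real \<Rightarrow> real^'n^'n"
    and W1 W1t W2 :: "real^'n^'k"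
    and K :: "real^'k^'k"
    and m m' :: "real \<Rightarrow> real"
  assumes ab: "a < b"
    and card: "CARD('n) = 2 * CARD('k)"
    and P1: "transpose P1 = P1" "invertible P1"
    and P0: "transpose P0 = - P0"
    and G0: "pos_semidef G0"
    and H1_Q: "H1_deriv a b Q Q'" and pos_Q: "\<And>x. x \<in> {a..b} \<Longrightarrow> pos_def (Q x)"
    and rank_W: "rank (vblock W1 W1t) = CARD('n)"
    and W1_P1: "transpose W1 ** W1t + transpose W1t ** W1 = P1"
    and W2_P1: "\<exists>W2t :: real^'n^'k. P1 = - (transpose W2 ** W2t + transpose W2t ** W2)"
    and deriv_m: "\<And>x. x \<in> {a..b} \<Longrightarrow> (m has_real_derivative m' x) (at x within {a..b})"
    and cont_m': "continuous_on {a..b} m'"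
    and m_left: "0 \<le> m a"
    and pos_As: "AE x in lebesgue_on {a..b}. pos_def (As_mat P1 P0 G0 Q Q' m m' x)"
begin

section \<open>Consequences of the hypotheses on the coefficients\<close>

lemma ac_Q: "ac_deriv a b Q Q'"
  by (rule H1_imp_ac_deriv[OF H1_Q])

lemma cont_Q: "continuous_on {a..b} Q"
  by (rule ac_deriv_continuous[OF ac_Q])

lemma transpose_Q: "x \<in> {a..b} \<Longrightarrow> transpose (Q x) = Q x"
  using pos_Q by (simp add: pos_def_def)

lemma inv_Q: "x \<in> {a..b} \<Longrightarrow> Q x ** matrix_inv (Q x) = mat 1 \<and> matrix_inv (Q x) ** Q x = mat 1"
  using pos_Q pos_def_invertible invertible_matrix_inv by blast

lemma cont_inv_Q: "continuous_on {a..b} (\<lambda>x. matrix_inv (Q x))"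
  by (intro continuous_on_matrix_inv cont_Q pos_def_invertible pos_Q)

lemma ac_m: "ac_deriv a b m m'"
  by (intro ac_deriv_C1 deriv_m cont_m')

lemma cont_m: "continuous_on {a..b} m"
  by (rule ac_deriv_continuous[OF ac_m])

text \<open>Testing \<open>As_mat\<close> on one fixed nonzero v gives m' q > m (v \<bullet> B v)
  with q = v \<bullet> Q v > 0. Division by q yields a scalar linear inequality for
  \<open>m\<close>. Its coefficient contains Q' and is only integrable, which is the generality of
  \<open>ac_deriv_nonneg\<close>.\<close>

lemma m_nonneg:
  assumes x: "x \<in> {a..b}"
  shows "0 \<le> m x"
proof -
  note bb = bounded_bilinear_matrix_vector_mult
  define v :: "real^'n" where "v = axis undefined 1"
  have "v \<noteq> 0" by (simp add: v_def axis_eq_0_iff)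
  define q where "q x = v \<bullet> (Q x *v v)" for x
  have q: "q x > 0" if "x \<in> {a..b}" for x
    using pos_Q[OF that] \<open>v \<noteq> 0\<close> by (simp add: q_def pos_def_def)
  have cQv: "continuous_on {a..b} (\<lambda>x. Q x *v w)" for w
    by (intro bounded_bilinear.continuous_on[OF bb] cont_Q continuous_on_const)
  have cq: "continuous_on {a..b} q"
    unfolding q_def by (intro continuous_intros cQv)
  let ?B = "B_mat P1 P0 G0 Q Q'"
  have Bv: "?B x *v v = Q' x *v v - Q x *v ((P0 + G0) *v (matrix_inv P1 *v v))
      + matrix_inv P1 *v ((P0 - G0) *v (Q x *v v))" for x
    unfolding B_mat_def
    by (simp only: matrix_vector_mult_add_rdistrib matrix_vector_mult_diff_rdistrib matrix_vector_mul_assoc[symmetric])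
  have iB: "integrable (lebesgue_on {a..b}) (\<lambda>x. ?B x *v v)"
    unfolding Bv
    by (intro Bochner_Integration.integrable_add Bochner_Integration.integrable_diff
        integrable_bilinear_continuous[OF bb ac_deriv_integrable[OF ac_Q]]
        continuous_imp_integrable_real continuous_on_const cQv
        bounded_linear.continuous_on[OF matrix_vector_mul_bounded_linear])
  have iqB: "integrable (lebesgue_on {a..b}) (\<lambda>x. inverse (q x) * (v \<bullet> (?B x *v v)))"
  proof (rule integrable_continuous_bilinear[OF bounded_bilinear_mult])
    show "continuous_on {a..b} (\<lambda>x. inverse (q x))"
      by (intro continuous_on_inverse cq) (metis q less_irrefl)
    show "integrable (lebesgue_on {a..b}) (\<lambda>x. v \<bullet> (?B x *v v))"
      by (intro integrable_continuous_bilinear[OF bounded_bilinear_inner] iB continuous_on_const)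
  qed
  show ?thesis
  proof (rule ac_deriv_nonneg[OF ac_m m_left iqB _ x])
    show "AE x in lebesgue_on {a..b}. m x * (inverse (q x) * (v \<bullet> (?B x *v v))) \<le> m' x"
      using pos_As
    proof (rule lebesgue_on_mono)
      fix x assume pd: "pos_def (As_mat P1 P0 G0 Q Q' m m' x)" and x: "x \<in> {a..b}"
      have "0 < v \<bullet> (As_mat P1 P0 G0 Q Q' m m' x *v v)"
        using pd \<open>v \<noteq> 0\<close> by (simp add: pos_def_def)
      also have "\<dots> = m' x * q x - m x * (v \<bullet> (?B x *v v))"
        unfolding As_mat_def q_def
        by (simp only: matrix_vector_mult_diff_rdistrib scaleR_matrix_vector_assoc[symmetric]
            inner_diff_right inner_scaleR_right)
      finally show "m x * (inverse (q x) * (v \<bullet> (?B x *v v))) \<le> m' x"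
        using q[OF x] by (simp add: field_simps)
    qed
  qed
qed

text \<open>The weight of the Lyapunov functional: H + \<epsilon> w is half of \<open>l2form\<close>
  with this weight and the state in both arguments.\<close>

definition lyap :: "real \<Rightarrow> real \<Rightarrow> real^'n^'n" where
  "lyap \<epsilon> x = Q x + (\<epsilon> * m x) *\<^sub>R matrix_inv P1"

lemma cont_lyap: "continuous_on {a..b} (lyap \<epsilon>)"
  unfolding lyap_def[abs_def] by (intro continuous_intros cont_Q cont_m)

lemma transpose_lyap: "x \<in> {a..b} \<Longrightarrow> transpose (lyap \<epsilon> x) = lyap \<epsilon> x"
  unfolding lyap_def using transpose_Q transpose_matrix_inv[OF P1]
  by (simp add: transpose_add_matrix transpose_scalar)

text \<open>The factorisation of \<open>P1\<close> through \<open>W2\<close> makes the form equal to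
  -2 (W2 e) \<bullet> (W2t e).\<close>

lemma boundary_left:
  assumes "W2 *v e = 0"
  shows "e \<bullet> (P1 *v e) = 0"
proof -
  obtain W2t :: "real^'n^'k" where W: "P1 = - (transpose W2 ** W2t + transpose W2t ** W2)"
    using W2_P1 by blast
  interpret bl: bounded_bilinear "(*v) :: real^'n^'n \<Rightarrow> real^'n \<Rightarrow> real^'n"
    by (rule bounded_bilinear_matrix_vector_mult)
  have "e \<bullet> (P1 *v e) = - (e \<bullet> (transpose W2 *v (W2t *v e)) + e \<bullet> (transpose W2t *v (W2 *v e)))"
    unfolding W by (simp only: bl.minus_left bl.add_left matrix_vector_mul_assoc inner_minus_right inner_add_right)
  also have "\<dots> = 0" by (simp only: inner_transpose_mult assms inner_zero_left inner_zero_right)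
  finally show ?thesis .
qed

text \<open>The factorisation through \<open>W1\<close> makes the form equal to 2 u \<bullet> y with
  u = W1 e, y = W1t e, and the boundary condition is u = - K y. The same condition expresses the
  stacked vector (u, y) by y alone, and the full rank recovers e from it; this is how
  \<open>Psi_mat\<close> arises.\<close>

lemma boundary_right:
  assumes "W1 *v e + K *v (W1t *v e) = 0"
  shows "e \<bullet> (P1 *v e) = - 2 * ((W1t *v e) \<bullet> (K *v (W1t *v e)))"
    and "e \<bullet> (matrix_inv (Q x) *v e) = (W1t *v e) \<bullet> (Psi_mat Q W1 W1t K x *v (W1t *v e))"
proof -
  interpret bl: bounded_bilinear "(*v) :: real^'n^'n \<Rightarrow> real^'n \<Rightarrow> real^'n"
    by (rule bounded_bilinear_matrix_vector_mult)
  interpret blk: bounded_bilinear "(*v) :: real^'k^'k \<Rightarrow> real^'k \<Rightarrow> real^'k"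
    by (rule bounded_bilinear_matrix_vector_mult)
  have u: "W1 *v e = - (K *v (W1t *v e))" using assms by (simp add: eq_neg_iff_add_eq_0)
  have "e \<bullet> (P1 *v e) = e \<bullet> (transpose W1 *v (W1t *v e)) + e \<bullet> (transpose W1t *v (W1 *v e))"
    unfolding W1_P1[symmetric] by (simp only: bl.add_left matrix_vector_mul_assoc inner_add_right)
  then show "e \<bullet> (P1 *v e) = - 2 * ((W1t *v e) \<bullet> (K *v (W1t *v e)))"
    by (simp only: inner_transpose_mult u) (simp add: inner_commute)
  have "vblock W1 W1t *v e = vblock (- K) (mat 1) *v (W1t *v e)"
    by (rule vblock_mult_eqI) (simp_all add: u blk.minus_left)
  moreover have "matrix_inv (vblock W1 W1t) *v (vblock W1 W1t *v e) = e"
    using full_rank_matrix_inv_left[OF rank_W] card by (simp add: matrix_vector_mul_assoc)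
  ultimately have "matrix_inv (vblock W1 W1t) *v (vblock (- K) (mat 1) *v (W1t *v e)) = e" by simp
  then show "e \<bullet> (matrix_inv (Q x) *v e) = (W1t *v e) \<bullet> (Psi_mat Q W1 W1t K x *v (W1t *v e))"
    by (simp only: Psi_mat_form)
qed

text \<open>If \<open>g\<close> is the time derivative of the state, then twice the form on the left
  is the derivative of the Lyapunov functional. Integrating \<open>dissipation_pointwise\<close>
  turns its derivative terms into boundary values of \<open>F1\<close> and
  \<open>F2\<close>.\<close>

lemma dissipation:
  assumes op: "phs_op a b P1 P0 G0 Q W1 W1t W2 K z g" and \<epsilon>: "\<epsilon> \<ge> 0"
    and As: "AE x in lebesgue_on {a..b}. pos_semidef (As_mat P1 P0 G0 Q Q' m m' x - c *\<^sub>R Q x)"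
    and bdry: "\<And>y. \<epsilon>/2 * (m b * (y \<bullet> (Psi_mat Q W1 W1t K b *v y))) \<le> y \<bullet> (K *v y)"
  shows "sq_integrable a b g" and "l2form a b (lyap \<epsilon>) z g \<le> - (\<epsilon> * c / 2) * l2form a b Q z z"
proof -
  note bb = bounded_bilinear_matrix_vector_mult
  interpret bl: bounded_bilinear "(*v) :: real^'n^'n \<Rightarrow> real^'n \<Rightarrow> real^'n"
    by (rule bounded_bilinear_matrix_vector_mult)
  obtain e e' where e: "H1_deriv a b e e'" and ez: "AE x in lebesgue_on {a..b}. e x = Q x *v z x"
    and bc: "W2 *v e a = 0" "W1 *v e b + K *v (W1t *v e b) = 0"
    and g: "AE x in lebesgue_on {a..b}. g x = P1 *v e' x + (P0 - G0) *v e x"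
    using op unfolding phs_op_def by blast
  have z: "sq_integrable a b z" using op by (simp add: phs_op_def)
  have ace: "ac_deriv a b e e'" by (rule H1_imp_ac_deriv[OF e])
  have se': "sq_integrable a b e'" using e unfolding H1_deriv_def by blast
  have sq_lin: "sq_integrable a b (\<lambda>x. A *v f x)" if "sq_integrable a b f" for f :: "real \<Rightarrow> real^'n" and A :: "real^'n^'n"
  proof -
    obtain B where B: "\<And>x. norm (A *v x) \<le> norm x * B"
      using bounded_linear.bounded[OF matrix_vector_mul_bounded_linear] by blast
    have m: "(\<lambda>x. A *v f x) \<in> borel_measurable (lebesgue_on {a..b})"
      using sq_integrable_measurable[OF that]
      by (rule measurable_compose)
        (intro borel_measurable_continuous_onI linear_continuous_on matrix_vector_mul_bounded_linear)
    have "integrable (lebesgue_on {a..b}) (\<lambda>x. (norm (A *v f x))\<^sup>2)"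
    proof (rule Bochner_Integration.integrable_bound)
      show "integrable (lebesgue_on {a..b}) (\<lambda>x. (norm (f x))\<^sup>2 * B\<^sup>2)"
        using that by (simp add: sq_integrable_def)
      show "AE x in lebesgue_on {a..b}. norm ((norm (A *v f x))\<^sup>2) \<le> norm ((norm (f x))\<^sup>2 * B\<^sup>2)"
        using power_mono[OF B norm_ge_zero, of _ 2] by (intro AE_I2) (simp add: power_mult_distrib)
    qed (use m in measurable)
    with m show ?thesis by (simp add: sq_integrable_def)
  qed
  show sg: "sq_integrable a b g"
  proof (rule sq_integrable_AE)
    show "sq_integrable a b (\<lambda>x. P1 *v e' x + (P0 - G0) *v e x)"
      by (intro sq_integrable_add sq_lin se' sq_integrable_continuous ac_deriv_continuous[OF ace])
    show "AE x in lebesgue_on {a..b}. P1 *v e' x + (P0 - G0) *v e x = g x"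
      using g by eventually_elim simp
  qed
  \<comment> \<open>\<open>z\<close> is known only almost everywhere; \<zeta> is its absolutely
    continuous representative and gives meaning to the boundary values of m z \<bullet> Q z.\<close>
  define \<zeta> where "\<zeta> x = matrix_inv (Q x) *v e x" for x
  define \<zeta>' where "\<zeta>' x = matrix_inv (Q x) *v (e' x - Q' x *v \<zeta> x)" for x
  have ac\<zeta>: "ac_deriv a b \<zeta> \<zeta>'"
    unfolding \<zeta>_def[abs_def] \<zeta>'_def[abs_def]
    by (rule ac_deriv_solve[OF ac_Q ace cont_inv_Q]) (use inv_Q in blast)
  define F1 F1' where "F1 x = e x \<bullet> (P1 *v e x)" and "F1' x = e' x \<bullet> (P1 *v e x) + e x \<bullet> (P1 *v e' x)" for x
  define F2 F2' where "F2 x = m x * (\<zeta> x \<bullet> e x)"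
    and "F2' x = m' x * (\<zeta> x \<bullet> e x) + m x * (\<zeta>' x \<bullet> e x + \<zeta> x \<bullet> e' x)" for x
  have F1: "ac_deriv a b F1 F1'"
    unfolding F1_def[abs_def] F1'_def[abs_def] by (rule ac_deriv_bilinear[OF bounded_bilinear_matrix_form ace ace])
  have F2: "ac_deriv a b F2 F2'"
    unfolding F2_def[abs_def] F2'_def[abs_def]
    by (intro ac_deriv_bilinear[OF bounded_bilinear_mult] ac_deriv_bilinear[OF bounded_bilinear_inner] ac_m ac\<zeta> ace)
  note iF = ac_deriv_integrable[OF F1] ac_deriv_integrable[OF F2]
  note iQ = l2form_integrable[OF cont_Q z z]
  have F1b: "F1 b = - 2 * ((W1t *v e b) \<bullet> (K *v (W1t *v e b)))" and F1a: "F1 a = 0"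
    unfolding F1_def by (rule boundary_right(1)[OF bc(2)], rule boundary_left[OF bc(1)])
  have F2b: "F2 b = m b * ((W1t *v e b) \<bullet> (Psi_mat Q W1 W1t K b *v (W1t *v e b)))"
    unfolding F2_def \<zeta>_def by (simp add: inner_commute[of _ "e b"] boundary_right(2)[OF bc(2)])
  \<comment> \<open>The left boundary value enters the balance with a minus sign, so m a \<ge> 0
    makes its contribution favourable.\<close>
  have F2a: "0 \<le> F2 a"
  proof -
    have "0 \<le> e a \<bullet> (matrix_inv (Q a) *v e a)"
      using pos_semidef_matrix_inv[OF pos_Q[of a]] ab by (simp add: pos_semidef_def)
    then show ?thesis unfolding F2_def \<zeta>_def using m_left by (simp add: inner_commute)
  qed
  have "l2form a b (lyap \<epsilon>) z g \<le> (LINT x|lebesgue_on {a..b}.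
      1/2 * F1' x + \<epsilon>/2 * F2' x - \<epsilon> * c / 2 * (z x \<bullet> (Q x *v z x)))"
    unfolding l2form_def
  proof (rule integral_mono_AE)
    show "integrable (lebesgue_on {a..b}) (\<lambda>x. z x \<bullet> (lyap \<epsilon> x *v g x))"
      by (rule l2form_integrable[OF cont_lyap z sg])
    show "integrable (lebesgue_on {a..b}) (\<lambda>x. 1/2 * F1' x + \<epsilon>/2 * F2' x - \<epsilon> * c / 2 * (z x \<bullet> (Q x *v z x)))"
      using iF iQ by simp
    have AE_in: "AE x in lebesgue_on {a..b}. x \<in> {a..b}"
      by (rule AE_I2) simp
    show "AE x in lebesgue_on {a..b}. z x \<bullet> (lyap \<epsilon> x *v g x) \<le>
       1/2 * F1' x + \<epsilon>/2 * F2' x - \<epsilon> * c / 2 * (z x \<bullet> (Q x *v z x))"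
      using AE_in ez g As
    proof eventually_elim
      case (elim x)
      have zeta: "\<zeta> x = z x"
        using inv_Q[OF elim(1)] unfolding \<zeta>_def elim(2) by (simp add: matrix_vector_mul_assoc)
      show ?case
        unfolding lyap_def F1'_def F2'_def zeta
        by (rule dissipation_pointwise[OF P1 P0 G0 pos_Q[OF elim(1)] \<epsilon> elim(4,2,3)])
          (simp add: \<zeta>'_def zeta)
    qed
  qed
  also have "\<dots> = 1/2 * (LINT x|lebesgue_on {a..b}. F1' x) + \<epsilon>/2 * (LINT x|lebesgue_on {a..b}. F2' x)
      - \<epsilon> * c / 2 * l2form a b Q z z"
    using iF iQ by (simp add: l2form_def)
  also have "\<dots> = 1/2 * (F1 b - F1 a) + \<epsilon>/2 * (F2 b - F2 a) - \<epsilon> * c / 2 * l2form a b Q z z"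
    using ac_deriv_diff[OF F1, of a b] ac_deriv_diff[OF F2, of a b] ab by simp
  also have "\<dots> \<le> - (\<epsilon> * c / 2) * l2form a b Q z z"
  proof -
    \<comment> \<open>With y = W1t e b the sum is - y \<bullet> K y + \<epsilon>/2 m b (y \<bullet>
      Psi y), exactly what \<open>bdry\<close> controls.\<close>
    have "1/2 * F1 b + \<epsilon>/2 * F2 b \<le> 0"
      unfolding F1b F2b using bdry[of "W1t *v e b"] by simp
    moreover have "0 \<le> \<epsilon>/2 * F2 a" using \<epsilon> F2a by simp
    moreover have "1/2 * (F1 b - F1 a) + \<epsilon>/2 * (F2 b - F2 a) = (1/2 * F1 b + \<epsilon>/2 * F2 b) - \<epsilon>/2 * F2 a"
      using F1a by (simp add: algebra_simps diff_divide_distrib)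
    ultimately have "1/2 * (F1 b - F1 a) + \<epsilon>/2 * (F2 b - F2 a) \<le> 0" by simp
    then show ?thesis by simp
  qed
  finally show "l2form a b (lyap \<epsilon>) z g \<le> - (\<epsilon> * c / 2) * l2form a b Q z z" .
qed

section \<open>Comparison with the energy and exponential decay\<close>

lemma lyap_equivalence:
  assumes z: "sq_integrable a b z" and \<epsilon>: "\<epsilon> \<ge> 0"
    and bound: "\<And>x v. x \<in> {a..b} \<Longrightarrow> \<bar>m x * (v \<bullet> (matrix_inv P1 *v v))\<bar> \<le> (v \<bullet> (Q x *v v)) / \<epsilon>0"
  shows "(1 - \<epsilon> / \<epsilon>0) * l2form a b Q z z \<le> l2form a b (lyap \<epsilon>) z z"
    and "l2form a b (lyap \<epsilon>) z z \<le> (1 + \<epsilon> / \<epsilon>0) * l2form a b Q z z"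
proof -
  have pw: "(1 - \<epsilon> / \<epsilon>0) * (v \<bullet> (Q x *v v)) \<le> v \<bullet> (lyap \<epsilon> x *v v) \<and>
      v \<bullet> (lyap \<epsilon> x *v v) \<le> (1 + \<epsilon> / \<epsilon>0) * (v \<bullet> (Q x *v v))" if "x \<in> {a..b}" for x v
  proof -
    have "v \<bullet> (lyap \<epsilon> x *v v) = v \<bullet> (Q x *v v) + \<epsilon> * (m x * (v \<bullet> (matrix_inv P1 *v v)))"
      unfolding lyap_def
      by (simp add: matrix_vector_mult_add_rdistrib scaleR_matrix_vector_assoc[symmetric] inner_add_right)
    moreover have "\<epsilon> * \<bar>m x * (v \<bullet> (matrix_inv P1 *v v))\<bar> \<le> \<epsilon> * ((v \<bullet> (Q x *v v)) / \<epsilon>0)"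
      using bound[OF that] \<epsilon> by (rule mult_left_mono)
    then have "\<bar>\<epsilon> * (m x * (v \<bullet> (matrix_inv P1 *v v)))\<bar> \<le> \<epsilon> * ((v \<bullet> (Q x *v v)) / \<epsilon>0)"
      using \<epsilon> by (simp add: abs_mult)
    ultimately show ?thesis by (simp add: algebra_simps abs_le_iff)
  qed
  note i = l2form_integrable[OF cont_Q z z] l2form_integrable[OF cont_lyap z z]
  have "(1 - \<epsilon> / \<epsilon>0) * l2form a b Q z z = (LINT x|lebesgue_on {a..b}. (1 - \<epsilon> / \<epsilon>0) * (z x \<bullet> (Q x *v z x)))"
    by (simp add: l2form_def)
  also have "\<dots> \<le> l2form a b (lyap \<epsilon>) z z"
    unfolding l2form_def using i pw by (intro integral_mono) auto
  finally show "(1 - \<epsilon> / \<epsilon>0) * l2form a b Q z z \<le> l2form a b (lyap \<epsilon>) z z" .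
  have "l2form a b (lyap \<epsilon>) z z \<le> (LINT x|lebesgue_on {a..b}. (1 + \<epsilon> / \<epsilon>0) * (z x \<bullet> (Q x *v z x)))"
    unfolding l2form_def using i pw by (intro integral_mono) auto
  also have "\<dots> = (1 + \<epsilon> / \<epsilon>0) * l2form a b Q z z"
    by (simp add: l2form_def)
  finally show "l2form a b (lyap \<epsilon>) z z \<le> (1 + \<epsilon> / \<epsilon>0) * l2form a b Q z z" .
qed

lemma classical_decay:
  assumes c: "c > 0" and \<epsilon>: "0 \<le> \<epsilon>" "\<epsilon> < \<epsilon>0"
    and As: "AE x in lebesgue_on {a..b}. pos_semidef (As_mat P1 P0 G0 Q Q' m m' x - c *\<^sub>R Q x)"
    and bdry: "\<And>y. \<epsilon>/2 * (m b * (y \<bullet> (Psi_mat Q W1 W1t K b *v y))) \<le> y \<bullet> (K *v y)"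
    and bound: "\<And>x v. x \<in> {a..b} \<Longrightarrow> \<bar>m x * (v \<bullet> (matrix_inv P1 *v v))\<bar> \<le> (v \<bullet> (Q x *v v)) / \<epsilon>0"
    and sol: "phs_classical_solution a b P1 P0 G0 Q W1 W1t W2 K z" and t: "t \<ge> 0"
  shows "phs_energy a b Q (z t) \<le>
    (\<epsilon>0 + \<epsilon>) / (\<epsilon>0 - \<epsilon>) * exp (- (c * \<epsilon> * \<epsilon>0 / (\<epsilon> + \<epsilon>0)) * t) * phs_energy a b Q (z 0)"
proof -
  define \<alpha> where "\<alpha> = c * \<epsilon> * \<epsilon>0 / (\<epsilon> + \<epsilon>0)"
  have e0: "\<epsilon>0 > 0" using \<epsilon> by simp
  \<comment> \<open>The identity explains the form of the rate: the upper comparison of V with the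
    \<open>Q\<close>-form turns the dissipation, c \<epsilon> times the \<open>Q\<close>-form, into
    at least \<alpha> V.\<close>
  have \<alpha>: "\<alpha> \<ge> 0" "\<alpha> * (1 + \<epsilon> / \<epsilon>0) = c * \<epsilon>"
  proof -
    show "\<alpha> \<ge> 0" using c \<epsilon> e0 by (simp add: \<alpha>_def)
    have "1 + \<epsilon> / \<epsilon>0 = (\<epsilon> + \<epsilon>0) / \<epsilon>0" using e0 by (simp add: field_simps)
    then show "\<alpha> * (1 + \<epsilon> / \<epsilon>0) = c * \<epsilon>" using \<epsilon> e0 by (simp add: \<alpha>_def)
  qed
  define V where "V s = l2form a b (lyap \<epsilon>) (z s) (z s)" for s
  have op: "\<exists>g. phs_op a b P1 P0 G0 Q W1 W1t W2 K (z s) g \<and> has_L2_deriv a b z g s" if "s \<ge> 0" for s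
    using sol that unfolding phs_classical_solution_def by blast
  have sq: "sq_integrable a b (z s)" if "s \<ge> 0" for s
    using op[OF that] by (auto simp: phs_op_def)
  note eqv = lyap_equivalence[OF sq \<epsilon>(1) bound]
  have dV: "\<exists>D. (V has_real_derivative D) (at s within {0..}) \<and> D \<le> - \<alpha> * V s" if s: "s \<ge> 0" for s
  proof -
    obtain g where g: "phs_op a b P1 P0 G0 Q W1 W1t W2 K (z s) g" "has_L2_deriv a b z g s"
      using op[OF s] by blast
    note diss = dissipation[OF g(1) \<epsilon>(1) As bdry]
    have "(V has_real_derivative 2 * l2form a b (lyap \<epsilon>) (z s) g) (at s within {0..})"
      unfolding V_def
      by (rule l2form_has_derivative[OF cont_lyap transpose_lyap sq diss(1) g(2) s])
    moreover have "2 * l2form a b (lyap \<epsilon>) (z s) g \<le> - (\<alpha> * ((1 + \<epsilon> / \<epsilon>0) * l2form a b Q (z s) (z s)))"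
      using diss(2) \<alpha>(2) by (simp add: mult.assoc[symmetric] mult.commute)
    moreover have "\<alpha> * V s \<le> \<alpha> * ((1 + \<epsilon> / \<epsilon>0) * l2form a b Q (z s) (z s))"
      unfolding V_def using eqv(2)[OF s] \<alpha>(1) by (intro mult_left_mono) auto
    ultimately show ?thesis by force
  qed
  define \<phi> where "\<phi> s = exp (\<alpha> * s) * V s" for s
  have d\<phi>: "\<exists>D. (\<phi> has_real_derivative D) (at s within {0..}) \<and> D \<le> 0" if s: "s \<ge> 0" for s
  proof -
    obtain D where D: "(V has_real_derivative D) (at s within {0..})" "D \<le> - \<alpha> * V s"
      using dV[OF s] by blast
    have "(\<phi> has_real_derivative exp (\<alpha> * s) * \<alpha> * V s + D * exp (\<alpha> * s)) (at s within {0..})"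
      unfolding \<phi>_def by (auto intro!: derivative_eq_intros D(1))
    moreover have "exp (\<alpha> * s) * \<alpha> * V s + D * exp (\<alpha> * s) = exp (\<alpha> * s) * (D + \<alpha> * V s)"
      by (simp add: algebra_simps)
    moreover have "\<dots> \<le> 0" using D(2) by (simp add: mult_le_0_iff)
    ultimately show ?thesis by auto
  qed
  have "\<phi> t \<le> \<phi> 0"
  \<comment> \<open>The derivative at time 0 is one-sided, so derivatives at interior times are
    combined with continuity up to the endpoint.\<close>
  proof (rule DERIV_nonpos_imp_decreasing_open[OF t])
    fix s assume s: "0 < s" "s < t"
    then have "at s within {0..} = at s"
      by (intro at_within_interior) (simp add: interior_Ici[of "-1"])
    then show "\<exists>y. DERIV \<phi> s :> y \<and> y \<le> 0" using d\<phi>[of s] s by simp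
  next
    have "continuous_on {0..} \<phi>"
      unfolding continuous_on_eq_continuous_within
      using d\<phi> DERIV_continuous by (metis atLeast_iff)
    then show "continuous_on {0..t} \<phi>" by (rule continuous_on_subset) auto
  qed
  then have V: "V t \<le> exp (- \<alpha> * t) * V 0"
    by (simp add: \<phi>_def exp_minus field_simps)
  have "(1 - \<epsilon> / \<epsilon>0) * l2form a b Q (z t) (z t) \<le> V t"
    unfolding V_def using eqv(1)[OF t] by blast
  also note V
  also have "exp (- \<alpha> * t) * V 0 \<le> exp (- \<alpha> * t) * ((1 + \<epsilon> / \<epsilon>0) * l2form a b Q (z 0) (z 0))"
    unfolding V_def using eqv(2)[of 0] by (intro mult_left_mono) auto
  \<comment> \<open>Multiplication by \<epsilon>0 produces the numerator and the denominator of
    M.\<close>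
  finally have "\<epsilon>0 * ((1 - \<epsilon> / \<epsilon>0) * l2form a b Q (z t) (z t)) \<le>
      \<epsilon>0 * (exp (- \<alpha> * t) * ((1 + \<epsilon> / \<epsilon>0) * l2form a b Q (z 0) (z 0)))"
    using e0 by (intro mult_left_mono) auto
  moreover have "\<epsilon>0 * (1 - \<epsilon> / \<epsilon>0) = \<epsilon>0 - \<epsilon>" "\<epsilon>0 * (1 + \<epsilon> / \<epsilon>0) = \<epsilon>0 + \<epsilon>"
    using e0 by (simp_all add: field_simps)
  ultimately have "(\<epsilon>0 - \<epsilon>) * l2form a b Q (z t) (z t) \<le> (\<epsilon>0 + \<epsilon>) * exp (- \<alpha> * t) * l2form a b Q (z 0) (z 0)"
    by (metis mult.assoc mult.left_commute)
  then show ?thesis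
    unfolding phs_energy_eq_l2form \<alpha>_def[symmetric] using \<epsilon> by (simp add: field_simps)
qed

text \<open>The operator maps Z (t + h) - Z t to z (t + h) - z t, since the terms z 0 cancel, and
  this is also the time derivative of Z (t + h) - Z t. So the mean of \<open>z\<close> over
  [t, t + h] is a classical trajectory even when \<open>z\<close> is not.\<close>

lemma mild_difference_quotient:
  assumes h: "h > 0"
    and Z: "\<And>t. t \<ge> 0 \<Longrightarrow> has_L2_deriv a b Z (z t) t"
      "\<And>t. t \<ge> 0 \<Longrightarrow> phs_op a b P1 P0 G0 Q W1 W1t W2 K (Z t) (\<lambda>x. z t x - z 0 x)"
    and z: "\<And>t. t \<ge> 0 \<Longrightarrow> sq_integrable a b (z t)"
  shows "phs_classical_solution a b P1 P0 G0 Q W1 W1t W2 K (\<lambda>t x. (1/h) *\<^sub>R (Z (t + h) x - Z t x))"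
  unfolding phs_classical_solution_def
proof (intro allI impI exI conjI)
  fix t :: real assume t: "t \<ge> 0"
  let ?g = "\<lambda>x. (1/h) *\<^sub>R (z (t + h) x - z t x)"
  show "phs_op a b P1 P0 G0 Q W1 W1t W2 K (\<lambda>x. (1/h) *\<^sub>R (Z (t + h) x - Z t x)) ?g"
    using phs_op_scaleR_diff[OF Z(2)[of "t + h"] Z(2)[of t], of "1/h"] t h by simp
  have sZ: "sq_integrable a b (Z s)" if "s \<ge> 0" for s
    using Z(2)[OF that] by (simp add: phs_op_def)
  define r where "r s x = (Z (s + h) x - Z (t + h) x) /\<^sub>R ((s + h) - (t + h)) - z (t + h) x" for s x
  define q where "q s x = (Z s x - Z t x) /\<^sub>R (s - t) - z t x" for s x
  have q: "((\<lambda>s. l2norm a b (q s)) \<longlongrightarrow> 0) (at t within {0..})"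
    using Z(1)[OF t] by (simp add: has_L2_deriv_def q_def[abs_def])
  \<comment> \<open>h > 0 keeps s + h in the half-line, and s + h differs from t + h for s different
    from t, so the L2 derivative of \<open>Z\<close> at t + h can be composed with the
    shift.\<close>
  have "filterlim (\<lambda>s. s + h) (at (t + h) within {0..}) (at t within {0..})"
    unfolding filterlim_at using h
    by (auto intro!: tendsto_eq_intros simp: eventually_at_filter)
  from filterlim_compose[OF Z(1)[unfolded has_L2_deriv_def, of "t + h"] this]
  have r: "((\<lambda>s. l2norm a b (r s)) \<longlongrightarrow> 0) (at t within {0..})"
    using t h by (simp add: r_def[abs_def])
  have "((\<lambda>s. sqrt ((1/h)\<^sup>2 * (2 * (l2norm a b (r s))\<^sup>2 + 2 * (l2norm a b (q s))\<^sup>2))) \<longlongrightarrow>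
      sqrt ((1/h)\<^sup>2 * (2 * 0\<^sup>2 + 2 * 0\<^sup>2))) (at t within {0..})"
    by (intro tendsto_intros q r)
  then have lim: "((\<lambda>s. sqrt ((1/h)\<^sup>2 * (2 * (l2norm a b (r s))\<^sup>2 + 2 * (l2norm a b (q s))\<^sup>2))) \<longlongrightarrow> 0) (at t within {0..})"
    by simp
  show "has_L2_deriv a b (\<lambda>t x. (1/h) *\<^sub>R (Z (t + h) x - Z t x)) ?g t"
    unfolding has_L2_deriv_def
  proof (rule Lim_null_comparison[OF _ lim])
    show "\<forall>\<^sub>F s in at t within {0..}.
       norm (l2norm a b (\<lambda>x. ((1/h) *\<^sub>R (Z (s + h) x - Z s x) - (1/h) *\<^sub>R (Z (t + h) x - Z t x)) /\<^sub>R (s - t) - ?g x))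
       \<le> sqrt ((1/h)\<^sup>2 * (2 * (l2norm a b (r s))\<^sup>2 + 2 * (l2norm a b (q s))\<^sup>2))"
      unfolding eventually_at_filter
    proof (intro always_eventually allI impI)
      fix s assume "s \<noteq> t" "s \<in> {0..}"
      then have s: "s \<ge> 0" by simp
      have sr: "sq_integrable a b (r s)"
        unfolding r_def by (intro sq_integrable_diff sq_integrable_scaleR sZ z) (use s t h in auto)
      \<comment> \<open>The sign is moved into the second summand so that
        \<open>l2norm_add_sq_le\<close> applies to the difference of the two remainders.\<close>
      have sq: "sq_integrable a b (\<lambda>x. (-1) *\<^sub>R q s x)"
        unfolding q_def by (intro sq_integrable_diff sq_integrable_scaleR sZ z) (use s t h in auto)
      let ?d = "\<lambda>x. ((1/h) *\<^sub>R (Z (s + h) x - Z s x) - (1/h) *\<^sub>R (Z (t + h) x - Z t x)) /\<^sub>R (s - t) - ?g x"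
      have "?d = (\<lambda>x. (1/h) *\<^sub>R (r s x + (-1) *\<^sub>R q s x))"
        by (simp add: r_def q_def fun_eq_iff algebra_simps)
      then have "(l2norm a b ?d)\<^sup>2 = (1/h)\<^sup>2 * (l2norm a b (\<lambda>x. r s x + (-1) *\<^sub>R q s x))\<^sup>2"
        by (simp only: l2norm_scaleR_sq)
      also have "\<dots> \<le> (1/h)\<^sup>2 * (2 * (l2norm a b (r s))\<^sup>2 + 2 * (l2norm a b (\<lambda>x. (-1) *\<^sub>R q s x))\<^sup>2)"
        by (intro mult_left_mono l2norm_add_sq_le sr sq) simp
      also have "l2norm a b (\<lambda>x. (-1) *\<^sub>R q s x) = l2norm a b (q s)"
        by (simp add: l2norm_def)
      finally show "norm (l2norm a b ?d) \<le> sqrt ((1/h)\<^sup>2 * (2 * (l2norm a b (r s))\<^sup>2 + 2 * (l2norm a b (q s))\<^sup>2))"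
        by (intro real_le_rsqrt) (simp add: power2_abs)
    qed
  qed
qed

text \<open>The factor in the classical estimate does not depend on h. As h tends to 0 from the
  right, the difference quotients of \<open>Z\<close> at times 0 and t converge in L2 to the values
  of \<open>z\<close>, and the energy is continuous in L2, so the inequality survives.\<close>

lemma mild_decay:
  assumes c: "c > 0" and \<epsilon>: "0 \<le> \<epsilon>" "\<epsilon> < \<epsilon>0"
    and As: "AE x in lebesgue_on {a..b}. pos_semidef (As_mat P1 P0 G0 Q Q' m m' x - c *\<^sub>R Q x)"
    and bdry: "\<And>y. \<epsilon>/2 * (m b * (y \<bullet> (Psi_mat Q W1 W1t K b *v y))) \<le> y \<bullet> (K *v y)"
    and bound: "\<And>x v. x \<in> {a..b} \<Longrightarrow> \<bar>m x * (v \<bullet> (matrix_inv P1 *v v))\<bar> \<le> (v \<bullet> (Q x *v v)) / \<epsilon>0"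
    and sol: "phs_mild_solution a b P1 P0 G0 Q W1 W1t W2 K z" and t: "t \<ge> 0"
  shows "phs_energy a b Q (z t) \<le>
    (\<epsilon>0 + \<epsilon>) / (\<epsilon>0 - \<epsilon>) * exp (- (c * \<epsilon> * \<epsilon>0 / (\<epsilon> + \<epsilon>0)) * t) * phs_energy a b Q (z 0)"
proof -
  have z: "\<And>t. t \<ge> 0 \<Longrightarrow> sq_integrable a b (z t)"
    using sol unfolding phs_mild_solution_def by blast
  obtain Z where Z: "\<And>t. t \<ge> 0 \<Longrightarrow> has_L2_deriv a b Z (z t) t"
      "\<And>t. t \<ge> 0 \<Longrightarrow> phs_op a b P1 P0 G0 Q W1 W1t W2 K (Z t) (\<lambda>x. z t x - z 0 x)"
    using sol unfolding phs_mild_solution_def by blast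
  have sZ: "sq_integrable a b (Z s)" if "s \<ge> 0" for s
    using Z(2)[OF that] by (simp add: phs_op_def)
  define w where "w h t x = (1/h) *\<^sub>R (Z (t + h) x - Z t x)" for h t x
  have lim: "((\<lambda>h. phs_energy a b Q (w h s)) \<longlongrightarrow> phs_energy a b Q (z s)) (at_right 0)" if s: "s \<ge> 0" for s
    unfolding phs_energy_eq_l2form
  proof (intro tendsto_divide l2form_tendsto cont_Q transpose_Q z s tendsto_const)
    show "\<forall>\<^sub>F h in at_right 0. sq_integrable a b (w h s)"
      unfolding eventually_at_filter w_def
      by (intro always_eventually allI impI sq_integrable_scaleR sq_integrable_diff sZ) (use s in auto)
    have "filterlim (\<lambda>h. s + h) (at s within {0..}) (at_right 0)"
      unfolding filterlim_at using s
      by (auto intro!: tendsto_eq_intros simp: eventually_at_filter)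
    from filterlim_compose[OF Z(1)[unfolded has_L2_deriv_def, OF s] this]
    show "((\<lambda>h. l2norm a b (\<lambda>x. w h s x - z s x)) \<longlongrightarrow> 0) (at_right 0)"
      by (simp add: w_def divide_inverse)
  qed auto
  let ?C = "(\<epsilon>0 + \<epsilon>) / (\<epsilon>0 - \<epsilon>) * exp (- (c * \<epsilon> * \<epsilon>0 / (\<epsilon> + \<epsilon>0)) * t)"
  show ?thesis
  proof (rule tendsto_le)
    show "((\<lambda>h. ?C * phs_energy a b Q (w h 0)) \<longlongrightarrow> ?C * phs_energy a b Q (z 0)) (at_right 0)"
      by (intro tendsto_intros lim) simp
    show "((\<lambda>h. phs_energy a b Q (w h t)) \<longlongrightarrow> phs_energy a b Q (z t)) (at_right 0)"
      by (rule lim[OF t])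
    show "\<forall>\<^sub>F h in at_right 0. phs_energy a b Q (w h t) \<le> ?C * phs_energy a b Q (w h 0)"
      unfolding eventually_at_filter
    proof (intro always_eventually allI impI)
      fix h :: real assume "h \<in> {0<..}"
      then have "h > 0" by simp
      then have "phs_classical_solution a b P1 P0 G0 Q W1 W1t W2 K (w h)"
        unfolding w_def[abs_def] by (rule mild_difference_quotient[OF _ Z z])
      from classical_decay[OF c \<epsilon> As bdry bound this t]
      show "phs_energy a b Q (w h t) \<le> ?C * phs_energy a b Q (w h 0)" .
    qed
  qed simp
qed

end

section \<open>The inequalities behind the two thresholds\<close>

lemma boundary_damping_threshold:
  fixes K :: "real^'k^'k" and Psi :: "real \<Rightarrow> real^'k^'k"
  assumes K: "pos_def K" and sym: "\<And>x. x \<in> {a..b} \<Longrightarrow> transpose (Psi x) = Psi x"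
    and Psi: "pos_semidef (Psi b)" and cont: "continuous_on {a..b} Psi" and ab: "a < b"
    and mb: "m b \<le> mum" and mum: "0 < mum"
    and \<epsilon>: "0 \<le> \<epsilon>" "\<epsilon> \<le> 2 * Min (eig K) / (mum * (SUP x\<in>{a..b}. Max (eig (Psi x))))"
  shows "\<epsilon>/2 * (m b * (y \<bullet> (Psi b *v y))) \<le> y \<bullet> (K *v y)"
proof -
  define \<mu> where "\<mu> = (SUP x\<in>{a..b}. Max (eig (Psi x)))"
  have Kge: "Min (eig K) * (norm y)\<^sup>2 \<le> y \<bullet> (K *v y)"
    using K by (intro Min_eig_le_form) (simp add: pos_def_def)
  have etaK: "0 \<le> Min (eig K)" by (rule Min_eig_nonneg[OF pos_def_imp_pos_semidef[OF K]])
  obtain D where D: "D > 0" "\<And>(A::real^'k^'k) v. norm (A *v v) \<le> norm A * norm v * D"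
    using bounded_bilinear.pos_bounded[OF bounded_bilinear_matrix_vector_mult] by blast
  obtain C where C: "\<And>x. x \<in> {a..b} \<Longrightarrow> norm (Psi x) \<le> C"
    using compact_continuous_image[OF cont] compact_imp_bounded by (force simp: bounded_iff)
  \<comment> \<open>A crude uniform bound ensures that the supremum \<mu> really dominates the value
    at \<open>b\<close>.\<close>
  have "Max (eig (Psi x)) \<le> C * D" if x: "x \<in> {a..b}" for x
  proof (rule Max_eig_le[OF sym[OF x]])
    fix v
    have "v \<bullet> (Psi x *v v) \<le> norm v * norm (Psi x *v v)" by (rule norm_cauchy_schwarz)
    also have "\<dots> \<le> norm v * (C * norm v * D)"
      using C[OF x] D(1) by (intro mult_left_mono order_trans[OF D(2)] mult_right_mono) auto
    finally show "v \<bullet> (Psi x *v v) \<le> C * D * (norm v)\<^sup>2"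
      by (simp add: power2_eq_square mult_ac)
  qed
  then have "bdd_above ((\<lambda>x. Max (eig (Psi x))) ` {a..b})"
    by (intro bdd_aboveI[of _ "C * D"]) auto
  then have "Max (eig (Psi b)) \<le> \<mu>"
    unfolding \<mu>_def using ab by (intro cSUP_upper) auto
  then have "Max (eig (Psi b)) * (norm y)\<^sup>2 \<le> \<mu> * (norm y)\<^sup>2" by (intro mult_right_mono) auto
  then have Psi_le: "y \<bullet> (Psi b *v y) \<le> \<mu> * (norm y)\<^sup>2"
    using form_le_Max_eig[OF sym, of b y] ab by simp
  have "m b * (y \<bullet> (Psi b *v y)) \<le> mum * (y \<bullet> (Psi b *v y))"
    using mb Psi by (intro mult_right_mono) (auto simp: pos_semidef_def)
  also have "\<dots> \<le> mum * (\<mu> * (norm y)\<^sup>2)"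
    using Psi_le mum by (intro mult_left_mono) auto
  finally have "\<epsilon>/2 * (m b * (y \<bullet> (Psi b *v y))) \<le> \<epsilon>/2 * (mum * (\<mu> * (norm y)\<^sup>2))"
    using \<epsilon> by (intro mult_left_mono) auto
  \<comment> \<open>Asking this coefficient to be at most \<open>Min (eig K)\<close> is the
    condition \<epsilon> \<le> eps1, including its factor 2.\<close>
  also have "\<dots> = (\<epsilon> * (mum * \<mu>) / 2) * (norm y)\<^sup>2" by simp
  also have "\<dots> \<le> Min (eig K) * (norm y)\<^sup>2"
  proof (rule mult_right_mono)
    show "\<epsilon> * (mum * \<mu>) / 2 \<le> Min (eig K)"
    \<comment> \<open>For \<mu> \<le> 0 the quotient yields no usable bound (at \<mu> = 0 its value
      is 0 by convention), but then the left side is nonpositive.\<close>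
    proof (cases "\<mu> > 0")
      case True
      then show ?thesis using \<epsilon>(2) mum unfolding \<mu>_def[symmetric] by (simp add: field_simps)
    next
      case False
      then have "\<epsilon> * (mum * \<mu>) \<le> 0" using \<epsilon>(1) mum by (simp add: mult_nonneg_nonpos)
      then show ?thesis using etaK by simp
    qed
  qed simp
  also note Kge
  finally show ?thesis .
qed

text \<open>The quotient is \<open>eps0\<close>. Since division by zero gives 0, its positivity
  makes each of the three constants nonzero, and nonnegativity is known for each separately. The
  bound then combines a lower bound for \<open>Q\<close> with an operator norm bound for the inverse
  of \<open>P1\<close>.\<close>

lemma multiplier_bound:
  fixes P1 :: "real^'n^'n" and Q :: "real \<Rightarrow> real^'n^'n"
  assumes P1: "transpose P1 = P1" "invertible P1"
    and pos_Q: "\<And>x. x \<in> {a..b} \<Longrightarrow> pos_def (Q x)" and ab: "a < b"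
    and m: "\<And>x. x \<in> {a..b} \<Longrightarrow> 0 \<le> m x \<and> m x \<le> mum"
    and pos: "0 < (INF x\<in>{a..b}. Min (eig (Q x))) / (mum * sqrt (Max (eig (matrix_inv P1 ** matrix_inv P1))))"
      (is "0 < ?\<eta> / (mum * ?\<mu>)")
    and x: "x \<in> {a..b}"
  shows "0 < mum" and "\<bar>m x * (v \<bullet> (matrix_inv P1 *v v))\<bar> \<le> (v \<bullet> (Q x *v v)) / (?\<eta> / (mum * ?\<mu>))"
proof -
  let ?Pi = "matrix_inv P1"
  have Pis: "transpose ?Pi = ?Pi" by (rule transpose_matrix_inv[OF P1])
  have PPs: "transpose (?Pi ** ?Pi) = ?Pi ** ?Pi" by (simp add: matrix_transpose_mul Pis)
  have Q0: "0 \<le> Min (eig (Q y))" if "y \<in> {a..b}" for y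
    by (rule Min_eig_nonneg[OF pos_def_imp_pos_semidef[OF pos_Q[OF that]]])
  \<comment> \<open>By symmetry the square of the inverse is its Gram matrix, so the largest
    eigenvalue of that square controls the squared operator norm.\<close>
  have Pi_le: "(norm (?Pi *v v))\<^sup>2 \<le> Max (eig (?Pi ** ?Pi)) * (norm v)\<^sup>2" for v
  proof -
    have "(norm (?Pi *v v))\<^sup>2 = v \<bullet> ((?Pi ** ?Pi) *v v)"
      using inner_matrix_symmetric[OF Pis, of v "?Pi *v v"]
      by (simp add: power2_norm_eq_inner matrix_vector_mul_assoc)
    then show ?thesis using form_le_Max_eig[OF PPs, of v] by simp
  qed
  have "0 \<le> Max (eig (?Pi ** ?Pi)) * (norm (axis undefined 1 :: real^'n))\<^sup>2"
    using Pi_le[of "axis undefined 1"] zero_le_power2 order_trans by blast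
  then have Max0: "0 \<le> Max (eig (?Pi ** ?Pi))" by simp
  have \<eta>0: "0 \<le> ?\<eta>" using ab Q0 by (intro cINF_greatest) auto
  show mum: "0 < mum"
    using m[OF x] pos by (metis div_by_0 le_less mult_zero_left order_trans less_irrefl)
  have \<mu>: "0 < ?\<mu>"
    using Max0 pos by (metis div_by_0 le_less mult_zero_right less_irrefl real_sqrt_ge_0_iff)
  have \<eta>: "0 < ?\<eta>" using \<eta>0 pos by (metis div_0 le_less less_irrefl)
  have "?\<eta> \<le> Min (eig (Q x))"
    using x Q0 by (intro cINF_lower bdd_belowI[of _ 0]) auto
  then have "?\<eta> * (norm v)\<^sup>2 \<le> Min (eig (Q x)) * (norm v)\<^sup>2" by (intro mult_right_mono) auto
  also have "\<dots> \<le> v \<bullet> (Q x *v v)"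
    using pos_Q[OF x] by (intro Min_eig_le_form) (simp add: pos_def_def)
  finally have Qge: "?\<eta> * (norm v)\<^sup>2 \<le> v \<bullet> (Q x *v v)" .
  have "norm (?Pi *v v) \<le> ?\<mu> * norm v"
    using real_le_rsqrt[OF Pi_le[of v]] by (simp add: real_sqrt_mult)
  then have "\<bar>v \<bullet> (?Pi *v v)\<bar> \<le> norm v * (?\<mu> * norm v)"
    by (intro order_trans[OF Cauchy_Schwarz_ineq2] mult_left_mono) auto
  then have "m x * \<bar>v \<bullet> (?Pi *v v)\<bar> \<le> mum * (norm v * (?\<mu> * norm v))"
    using m[OF x] by (intro mult_mono) auto
  then have "\<bar>m x * (v \<bullet> (?Pi *v v))\<bar> \<le> mum * ?\<mu> * (norm v)\<^sup>2"
    using m[OF x] by (simp add: abs_mult power2_eq_square mult_ac)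
  also have "\<dots> = mum * ?\<mu> / ?\<eta> * (?\<eta> * (norm v)\<^sup>2)" using \<eta> by simp
  also have "\<dots> \<le> mum * ?\<mu> / ?\<eta> * (v \<bullet> (Q x *v v))"
    using Qge \<eta> \<mu> mum by (intro mult_left_mono) auto
  also have "\<dots> = (v \<bullet> (Q x *v v)) / (?\<eta> / (mum * ?\<mu>))" by simp
  finally show "\<bar>m x * (v \<bullet> (?Pi *v v))\<bar> \<le> (v \<bullet> (Q x *v v)) / (?\<eta> / (mum * ?\<mu>))" .
qed

lemma continuous_on_Psi_mat:
  assumes "continuous_on S (\<lambda>x. matrix_inv (Q x))"
  shows "continuous_on S (Psi_mat Q W1 W1t K)"
proof -
  have mm: "continuous_on S (\<lambda>x. A ** R x)" "continuous_on S (\<lambda>x. R x ** B)"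
    if "continuous_on S R" for A :: "real^'p^'q" and B :: "real^'r^'s" and R :: "_ \<Rightarrow> real^'s^'p"
    unfolding matrix_matrix_mult_def
    by (intro continuous_on_vec_lambda continuous_intros that)+
  show ?thesis
    unfolding Psi_mat_def[abs_def] by (intro mm assms)
qed

section \<open>Exponential decay\<close>

theorem theorem1:
  fixes a b :: real
    and P1 P0 G0 :: "real^'n^'n"
    and Q Q' :: "real \<Rightarrow> real^'n^'n"
    and W1 W1t W2 :: "real^'n^'k"
    and K :: "real^'k^'k"
    and m m' :: "real \<Rightarrow> real"
    and z :: "real \<Rightarrow> real \<Rightarrow> real^'n"
    and etaQ etaK muPsi muP1 mum eps0 eps1 eps c M \<alpha> :: real
  assumes "a < b"
    and "CARD('n) = 2 * CARD('k)"
    and "transpose P1 = P1" and "invertible P1"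
    and "transpose P0 = - P0"
    and "pos_semidef G0"
    and "H1_deriv a b Q Q'" and "\<forall>x\<in>{a..b}. pos_def (Q x)"
    and "rank (vblock (hblock 0 W2) (hblock W1 0)) = CARD('n)"
    and "rank (vblock W1 W1t) = CARD('n)"
    and "transpose W1 ** W1t + transpose W1t ** W1 = P1"
    and "\<exists>W2t :: real^'n^'k. P1 = - (transpose W2 ** W2t + transpose W2t ** W2)"
    and "pos_def K"
    and "\<forall>x\<in>{a..b}. (m has_real_derivative m' x) (at x within {a..b})"
    and "continuous_on {a..b} m'"
    and m_nonneg_left: "0 \<le> m a"
    and "etaQ = (INF x\<in>{a..b}. Min (eig (Q x)))"
    and "etaK = Min (eig K)"
    and "muPsi = (SUP x\<in>{a..b}. Max (eig (Psi_mat Q W1 W1t K x)))"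
    and "muP1 = sqrt (Max (eig (matrix_inv P1 ** matrix_inv P1)))"
    and "mum = (SUP x\<in>{a..b}. m x)"
    and "eps0 = etaQ / (mum * muP1)"
    and "eps1 = 2 * etaK / (mum * muPsi)"
    and "AE x in lebesgue_on {a..b}. pos_def (As_mat P1 P0 G0 Q Q' m m' x)"
    and "c > 0"
    and "AE x in lebesgue_on {a..b}. pos_semidef (As_mat P1 P0 G0 Q Q' m m' x - c *\<^sub>R Q x)"
    and "eps \<in> {0..min eps0 eps1}" and "eps < eps0"
    and "M = (eps0 + eps) / (eps0 - eps)"
    and "\<alpha> = c * eps * eps0 / (eps + eps0)"
    and "phs_classical_solution a b P1 P0 G0 Q W1 W1t W2 K z \<or>
         phs_mild_solution a b P1 P0 G0 Q W1 W1t W2 K z"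
  shows "\<forall>t\<ge>0. phs_energy a b Q (z t) \<le> M * exp (- \<alpha> * t) * phs_energy a b Q (z 0)"
proof (intro allI impI)
  fix t :: real assume t: "0 \<le> t"
  interpret boundary_damped_phs a b P1 P0 G0 Q Q' W1 W1t W2 K m m'
    by standard (use assms(1-8,10-12,14-16,24) in auto)
  note pos_Q' = assms(8)[rule_format]
  have eps: "0 \<le> eps" "eps \<le> eps1" "eps < eps0"
    using assms(27,28) by auto
  have m_le: "m x \<le> mum" if "x \<in> {a..b}" for x
    unfolding assms(21) using that compact_continuous_image[OF cont_m] 
    by (intro cSUP_upper bounded_imp_bdd_above compact_imp_bounded) auto
  have eps0: "eps0 = (INF x\<in>{a..b}. Min (eig (Q x))) / (mum * sqrt (Max (eig (matrix_inv P1 ** matrix_inv P1))))"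
    by (simp only: assms(17,20,22))
  \<comment> \<open>Positivity of \<open>eps0\<close> is read off from 0 \<le> eps < eps0.\<close>
  have pos: "0 < (INF x\<in>{a..b}. Min (eig (Q x))) / (mum * sqrt (Max (eig (matrix_inv P1 ** matrix_inv P1))))"
    using eps unfolding eps0[symmetric] by simp
  have m_range: "0 \<le> m x \<and> m x \<le> mum" if "x \<in> {a..b}" for x
    using m_nonneg m_le that by blast
  have mum: "0 < mum"
    by (rule multiplier_bound(1)[where m=m and x=a, OF P1 pos_Q' ab m_range pos]) (use ab in auto)
  have bound: "\<bar>m x * (v \<bullet> (matrix_inv P1 *v v))\<bar> \<le> (v \<bullet> (Q x *v v)) / eps0" if "x \<in> {a..b}" for x v
    unfolding eps0 by (rule multiplier_bound(2)[where m=m, OF P1 pos_Q' ab m_range pos that]) auto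
  have R: "pos_semidef (matrix_inv (Q x))" if "x \<in> {a..b}" for x
    by (rule pos_semidef_matrix_inv[OF pos_Q'[OF that]])
  have bdry: "eps/2 * (m b * (y \<bullet> (Psi_mat Q W1 W1t K b *v y))) \<le> y \<bullet> (K *v y)" for y
  proof (rule boundary_damping_threshold[where a=a and mum=mum])
    show sym: "transpose (Psi_mat Q W1 W1t K x) = Psi_mat Q W1 W1t K x" if "x \<in> {a..b}" for x
      using R[OF that] by (intro transpose_Psi_mat) (simp add: pos_semidef_def)
    show "pos_semidef (Psi_mat Q W1 W1t K b)"
      using R[of b] sym[of b] ab by (simp add: pos_semidef_def Psi_mat_form)
    show "eps \<le> 2 * Min (eig K) / (mum * (SUP x\<in>{a..b}. Max (eig (Psi_mat Q W1 W1t K x))))"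
      using eps(2) by (simp only: assms(18,19,23))
  qed (use assms(13) ab m_le mum eps continuous_on_Psi_mat[OF cont_inv_Q] in auto)
  show "phs_energy a b Q (z t) \<le> M * exp (- \<alpha> * t) * phs_energy a b Q (z 0)"
    using assms(31)
  proof
    assume "phs_classical_solution a b P1 P0 G0 Q W1 W1t W2 K z"
    then show ?thesis
      unfolding assms(29,30) by (intro classical_decay[OF assms(25) eps(1,3) assms(26) bdry] bound t)
  next
    assume "phs_mild_solution a b P1 P0 G0 Q W1 W1t W2 K z"
    then show ?thesis
      unfolding assms(29,30) by (intro mild_decay[OF assms(25) eps(1,3) assms(26) bdry] bound t)
  qed
qed

end
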